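(* For a nonnegative integer $n$, let $p_8(n)$ denote the number of $8$-colour partitions of $n$, i.e. $\sum_{n\ge 0} p_8(n)q^n=\prod_{j\ge1}(1-q^j)^{-8}$. Then for all nonnegative integers $n$ and all integers $\alpha\geq 1$: \begin{align*} p_8(2n+1) &\equiv 0 \pmod{2^3},\\ p_8\!\left(2^{2\alpha}n + \tfrac{2^{2\alpha+1}+1}{3}\right) &\equiv 0 \pmod{2^{3\alpha+3}},\\ p_8\!\left(2^{2\alpha+1}n + \tfrac{7\cdot 2^{2\alpha-1}+1}{3}\right) &\equiv 0 \pmod{2^{3\alpha+2}},\\ p_8\!\left(2^{2\alpha+1}n + \tfrac{5\cdot 2^{2\alpha}+1}{3}\right) &\equiv 0 \pmod{2^{3\alpha+8}},\\ p_8\!\left(2^{2\alpha+2}n + \tfrac{13\cdot 2^{2\alpha-1}+1}{3}\right) &\equiv 0 \pmod{2^{3\alpha+1}},\\ p_8\!\left(2^{2\alpha+2}n + \tfrac{19\cdot 2^{2\alpha-1}+1}{3}\right) &\equiv 0 \pmod{2^{3\alpha+3}},\\ p_8\!\left(2^{2\alpha+2}n + \tfrac{11\cdot 2^{2\alpha}+1}{3}\right) &\equiv 0 \pmod{2^{3\alpha+10}},\\ p_8\!\left(2^{2\alpha+3}n + \tfrac{17\cdot 2^{2\alpha}+1}{3}\right) &\equiv 0 \pmod{2^{3\alpha+9}}, \end{align*} and, if $n$ is not a generalised pentagonal number (i.e. $n\neq k(3k-1)/2$ for every integer $k$), then \[p_8\!\left(2^{2\alpha+2}n + \tfrac{2^{2\alpha-1}+1}{3}\right)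 \equiv 0 \pmod{2^{3\alpha+1}}.\]
   Context: $p_8(n)$ is defined by the generating function $\sum_{n=0}^\infty p_8(n)q^n = \prod_{j=1}^\infty (1-q^j)^{-8}$. A generalised pentagonal number is an integer of the form $k(3k-1)/2$ with $k\in\mathbb{Z}$. *)

theory Defs
  imports
    "HOL-Analysis.Analysis"
    "HOL-Number_Theory.Cong"
    "HOL-Computational_Algebra.Formal_Power_Series"
begin

(* The product is the limit in the X-adic topology on formal power series; its index is shifted
   by one, so that j ranges over 0, 1, 2, ...  Rational coefficients are used because the
   inverse of a power series is only available over a field. *)
definition p8_gf :: "rat fps" where
  "p8_gf = prodinf (\<lambda>j. inverse ((1 - fps_X ^ Suc j) ^ 8))"

(* The lemmas p8_gf_has_prod and p8_generating_function below show that the product converges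
   and that this description always determines a natural number. *)
definition p8 :: "nat \<Rightarrow> nat" where
  "p8 n = (THE m. of_nat m = fps_nth p8_gf n)"

definition generalised_pentagonal :: "int \<Rightarrow> bool" where
  "generalised_pentagonal n \<longleftrightarrow> (\<exists>k::int. n = k * (3 * k - 1) div 2)"

lemma inverse_one_minus_fps_X_power:
  "inverse (1 - fps_X ^ Suc j :: rat fps) = Abs_fps (\<lambda>n. if Suc j dvd n then 1 else 0)"
proof (rule fps_inverse_unique)
  show "(1 - fps_X ^ Suc j) * Abs_fps (\<lambda>n. if Suc j dvd n then 1 else 0) = (1 :: rat fps)"
  proof (rule fps_ext)
    fix n
    show "fps_nth ((1 - fps_X ^ Suc j) * Abs_fps (\<lambda>n. if Suc j dvd n then 1 else 0)) n
        = fps_nth (1 :: rat fps) n"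
    proof (cases "n < Suc j")
      case True
      then show ?thesis
        by (auto simp: left_diff_distrib fps_X_power_mult_nth simp del: power_Suc
              dest: dvd_imp_le)
    next
      case False
      then have "Suc j dvd n - Suc j \<longleftrightarrow> Suc j dvd n"
        by (simp add: dvd_minus_self)
      with False show ?thesis
        by (simp add: left_diff_distrib fps_X_power_mult_nth del: power_Suc)
    qed
  qed
qed

lemma fps_nth_mult_Nats:
  fixes F G :: "rat fps"
  assumes "\<And>n. fps_nth F n \<in> \<nat>" "\<And>n. fps_nth G n \<in> \<nat>"
  shows "fps_nth (F * G) n \<in> \<nat>"
proof -
  have "(\<Sum>i\<in>A. fps_nth F i * fps_nth G (n - i)) \<in> \<nat>" for A
    using assms by (induction A rule: infinite_finite_induct) auto
  then show ?thesis by (simp add: fps_mult_nth)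
qed

lemma fps_nth_power_Nats:
  fixes F :: "rat fps"
  assumes "\<And>n. fps_nth F n \<in> \<nat>"
  shows "fps_nth (F ^ k) n \<in> \<nat>"
proof (induction k arbitrary: n)
  case 0
  then show ?case by simp
next
  case (Suc k)
  then show ?case by (simp add: fps_nth_mult_Nats assms)
qed

lemma fps_nth_mult_low:
  fixes F G :: "rat fps"
  assumes "fps_nth G 0 = 1" "\<And>i. 0 < i \<Longrightarrow> i \<le> n \<Longrightarrow> fps_nth G i = 0"
  shows "fps_nth (F * G) n = fps_nth F n"
proof -
  have "fps_nth (F * G) n = (\<Sum>i=0..n. if i = n then fps_nth F n else 0)"
    unfolding fps_mult_nth using assms by (intro sum.cong) auto
  then show ?thesis by simp
qed

lemma fps_nth_power_low:
  fixes G :: "rat fps"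
  assumes "fps_nth G 0 = 1" "\<And>i. 0 < i \<Longrightarrow> i \<le> n \<Longrightarrow> fps_nth G i = 0"
  shows "i \<le> n \<Longrightarrow> fps_nth (G ^ k) i = (if i = 0 then 1 else 0)"
proof (induction k arbitrary: i)
  case 0
  then show ?case by simp
next
  case (Suc k)
  then show ?case
    using fps_nth_mult_low[of G i "G ^ k"] assms by (simp add: mult.commute)
qed

lemma p8_factor_Nats: "fps_nth (inverse ((1 - fps_X ^ Suc j) ^ 8) :: rat fps) n \<in> \<nat>"
  unfolding fps_inverse_power inverse_one_minus_fps_X_power by (rule fps_nth_power_Nats) auto

lemma p8_factor_low:
  "n \<le> j \<Longrightarrow> fps_nth (inverse ((1 - fps_X ^ Suc j) ^ 8) :: rat fps) n = (if n = 0 then 1 else 0)"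
  unfolding fps_inverse_power inverse_one_minus_fps_X_power
  by (rule fps_nth_power_low[where n = j]) (auto dest: dvd_imp_le)

lemma p8_prod_Nats: "fps_nth (\<Prod>j\<le>N. inverse ((1 - fps_X ^ Suc j) ^ 8) :: rat fps) n \<in> \<nat>"
proof (induction N arbitrary: n)
  case 0
  show ?case using p8_factor_Nats[of 0] by simp
next
  case (Suc N)
  show ?case unfolding prod.atMost_Suc by (intro fps_nth_mult_Nats Suc.IH p8_factor_Nats)
qed

lemma p8_prod_stable:
  "n \<le> N \<Longrightarrow> fps_nth (\<Prod>j\<le>N. inverse ((1 - fps_X ^ Suc j) ^ 8) :: rat fps) n
     = fps_nth (\<Prod>j\<le>n. inverse ((1 - fps_X ^ Suc j) ^ 8) :: rat fps) n"
proof (induction N rule: dec_induct)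
  case base
  show ?case ..
next
  case (step N)
  have low: "fps_nth (inverse ((1 - fps_X ^ Suc (Suc N)) ^ 8) :: rat fps) i
      = (if i = 0 then 1 else 0)" if "i \<le> n" for i
    using p8_factor_low[of i "Suc N"] that step.hyps by simp
  have "fps_nth (\<Prod>j\<le>Suc N. inverse ((1 - fps_X ^ Suc j) ^ 8) :: rat fps) n
      = fps_nth (\<Prod>j\<le>N. inverse ((1 - fps_X ^ Suc j) ^ 8) :: rat fps) n"
    unfolding prod.atMost_Suc by (rule fps_nth_mult_low) (simp_all only: low, simp_all)
  with step.IH show ?case by simp
qed

lemma p8_gf_has_prod: "(\<lambda>j. inverse ((1 - fps_X ^ Suc j) ^ 8)) has_prod p8_gf"
  and p8_gf_nth: "fps_nth p8_gf n = fps_nth (\<Prod>j\<le>n. inverse ((1 - fps_X ^ Suc j) ^ 8)) n"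
proof -
  define f :: "nat \<Rightarrow> rat fps" where "f = (\<lambda>j. inverse ((1 - fps_X ^ Suc j) ^ 8))"
  define G where "G = Abs_fps (\<lambda>n. fps_nth (\<Prod>j\<le>n. f j) n)"
  have lim: "(\<lambda>N. \<Prod>j\<le>N. f j) \<longlonglongrightarrow> G"
  proof (rule tendsto_fpsI)
    fix n
    show "eventually (\<lambda>N. fps_nth (\<Prod>j\<le>N. f j) n = fps_nth G n) sequentially"
      using eventually_ge_at_top[of n]
      unfolding G_def f_def fps_nth_Abs_fps by eventually_elim (rule p8_prod_stable)
  qed
  have f0: "fps_nth (f j) 0 = 1" for j
    using p8_factor_low[of 0 j] unfolding f_def by (simp del: power_Suc)
  have nz: "f j \<noteq> 0" for j
    using f0[of j] by auto
  have "fps_nth G 0 = 1"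
    unfolding G_def fps_nth_Abs_fps using f0[of 0] by simp
  then have "G \<noteq> 0" by auto
  with lim have hp: "f has_prod G"
    unfolding has_prod_def raw_has_prod_def by simp
  have "x = G" if "f has_prod x" for x
    using that nz lim unfolding has_prod_def raw_has_prod_def
    by (auto intro: LIMSEQ_unique)
  with hp have eq: "p8_gf = G"
    unfolding p8_gf_def prodinf_def f_def[symmetric] by (rule the_equality)
  show "(\<lambda>j. inverse ((1 - fps_X ^ Suc j) ^ 8)) has_prod p8_gf"
    using hp unfolding eq f_def .
  show "fps_nth p8_gf n = fps_nth (\<Prod>j\<le>n. inverse ((1 - fps_X ^ Suc j) ^ 8)) n"
    unfolding eq G_def f_def by (rule fps_nth_Abs_fps)
qed

lemma p8_generating_function: "Abs_fps (\<lambda>n. of_nat (p8 n)) = p8_gf"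
proof (rule fps_ext)
  fix n
  obtain m where m: "of_nat m = fps_nth p8_gf n"
    using p8_prod_Nats[of n n] unfolding p8_gf_nth by (metis Nats_cases)
  then have "p8 n = m"
    unfolding p8_def by (intro the_equality) (auto simp flip: m)
  with m show "fps_nth (Abs_fps (\<lambda>n. of_nat (p8 n))) n = fps_nth p8_gf n"
    by simp
qed

end

theory Submission
  imports Defs
begin

text \<open>
  Write \<open>fk\<close> for the product of the \<open>1 - q^(k j)\<close> over \<open>j \<ge> 1\<close>. Jacobi's identity
  \<open>f1(-q)^8 - f1(q)^8 = 16 q f4^8\<close>, a consequence of the triple product, gives
  \<open>\<Sum> p8(2n+1) q^n = 8 h\<close> with \<open>h = f2^16 / f1^24\<close>. Put \<open>k = f2^24 / f1^32\<close> and
  \<open>s = 128 q f2^24 / f1^24\<close>. Taking odd parts maps \<open>h \<int>[s]\<close> into \<open>8 k \<int>[s]\<close>, taking even parts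
  maps \<open>k \<int>[s]\<close> into \<open>h \<int>[s]\<close>; this follows from two initial values each and the quadratic equation
  of \<open>s\<close> over the series in \<open>q^2\<close>. Alternating the two maps shows that the subsequences of \<open>p8\<close> in
  question are, up to a factor \<open>8^a\<close> and modulo \<open>128\<close>, integer multiples of the coefficients of \<open>h\<close> and
  \<open>k\<close>. Finally \<open>h\<close> is congruent to \<open>f2^4\<close> modulo \<open>8\<close>, the odd part of \<open>k\<close> to \<open>32 f2^10\<close> modulo
  \<open>128\<close>, and \<open>F(q)^2\<close> to \<open>F(q^2)\<close> modulo \<open>2\<close> for every integral series \<open>F\<close>.
\<close>

subsection \<open>The Gaussian binomial theorem\<close>

text \<open>Write \<open>P = 1/f1^8\<close> as \<open>u(q^2) + q v(q^2)\<close>. Jacobi's identity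
  fixes \<open>v\<close>, and \<open>u^2\<close> follows because \<open>P(q) P(-q)\<close> is an eta
  quotient in \<open>q^2\<close>. Factors in \<open>q^2\<close> pass through even and odd parts, so
  these two relations dissect every eta quotient in play. They also yield the quadratic equation:
  \<open>s(q)\<close> and \<open>s(-q)\<close> are its two roots over the series in
  \<open>q^2\<close>. The 3 in the progressions is the one in \<open>eta^(-8) = q^(-1/3) P\<close>:
  a position \<open>N\<close> matters through \<open>3 N - 1\<close>. An odd part followed by an
  even part multiplies the power of two split off from \<open>3 N - 1\<close> by 4, which is why the
  two parts alternate. Each such round yields a factor 8, matching the \<open>3 \<alpha>\<close> in
  the exponents. The 128 comes from the strongest claim,
  \<open>3 \<alpha> + 10 = 3 (\<alpha> + 1) + 7\<close>. Since \<open>s\<close> is divisible by 128,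
  a polynomial in \<open>s\<close> collapses to its constant term, whose value does not affect
  divisibility. Divisibility forces integral series, so quotients are avoided: negative powers of
  \<open>f1\<close> are powers of \<open>P\<close>, and other denominators are multiplied out and
  cancelled.\<close>

fun qbinomial :: "'a::comm_ring_1 \<Rightarrow> nat \<Rightarrow> nat \<Rightarrow> 'a" where
  "qbinomial Q n 0 = 1"
| "qbinomial Q 0 (Suc k) = 0"
| "qbinomial Q (Suc n) (Suc k) = qbinomial Q n (Suc k) + Q ^ (n - k) * qbinomial Q n k"

lemma qbinomial_eq_0: "n < k \<Longrightarrow> qbinomial Q n k = 0"
  by (induction Q n k rule: qbinomial.induct) auto

lemma Suc_choose_two: "Suc k choose 2 = k + (k choose 2)"
  by (simp add: numeral_2_eq_2)

theorem qbinomial_theorem: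
  fixes x y Q :: "'a::comm_ring_1"
  shows "(\<Prod>i<n. x + y * Q ^ i)
    = (\<Sum>k\<le>n. Q ^ (k choose 2) * qbinomial Q n k * y ^ k * x ^ (n - k))"
proof (induction n)
  case 0
  show ?case by (simp add: binomial_eq_0)
next
  case (Suc n)
  define T where "T n k = Q ^ (k choose 2) * qbinomial Q n k * y ^ k * x ^ (n - k)" for n k
  have T_Suc: "T (Suc n) (Suc k) = x * T n (Suc k) + y * Q ^ n * T n k" if "k \<le> n" for k
  proof -
    \<comment> \<open>At \<open>k = n\<close> truncated subtraction breaks
      \<open>n - k = Suc (n - Suc k)\<close>; there the Gaussian coefficient is 0.\<close>
    have a: "qbinomial Q n (Suc k) * x ^ (n - k) = qbinomial Q n (Suc k) * (x * x ^ (n - Suc k))"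
    proof (cases "k = n")
      case True
      then show ?thesis by (simp add: qbinomial_eq_0)
    next
      case False
      with that have "n - k = Suc (n - Suc k)" by simp
      then show ?thesis by (simp only: power_Suc)
    qed
    have b: "Q ^ (k + (k choose 2)) * Q ^ (n - k) = Q ^ n * Q ^ (k choose 2)"
      using that by (simp only: power_add[symmetric]) (simp add: add.commute)
    have "T (Suc n) (Suc k) = Q ^ (k + (k choose 2)) * y ^ Suc k * (qbinomial Q n (Suc k) * x ^ (n - k))
        + (Q ^ (k + (k choose 2)) * Q ^ (n - k)) * (y * y ^ k) * qbinomial Q n k * x ^ (n - k)"
      by (simp only: T_def Suc_choose_two qbinomial.simps power_Suc diff_Suc_Suc algebra_simps)
    also have "\<dots> = x * T n (Suc k) + y * Q ^ n * T n k"
      unfolding a b by (simp only: T_def Suc_choose_two mult_ac)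
    finally show ?thesis .
  qed
  have "(\<Sum>k\<le>Suc n. T (Suc n) k) = T (Suc n) 0 + (\<Sum>k\<le>n. T (Suc n) (Suc k))"
    by (rule sum.atMost_Suc_shift)
  also have "(\<Sum>k\<le>n. T (Suc n) (Suc k)) = (\<Sum>k\<le>n. x * T n (Suc k) + y * Q ^ n * T n k)"
    by (intro sum.cong refl T_Suc) simp
  also have "T (Suc n) 0 = x * T n 0"
    by (simp add: T_def algebra_simps)
  also have "x * T n 0 + (\<Sum>k\<le>n. x * T n (Suc k) + y * Q ^ n * T n k)
      = x * (\<Sum>k\<le>Suc n. T n k) + y * Q ^ n * (\<Sum>k\<le>n. T n k)"
    by (simp only: sum.distrib sum.atMost_Suc_shift sum_distrib_left algebra_simps)
  also have "(\<Sum>k\<le>Suc n. T n k) = (\<Sum>k\<le>n. T n k)"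
    by (simp add: T_def qbinomial_eq_0)
  also have "(\<Sum>k\<le>n. T n k) = (\<Prod>i<n. x + y * Q ^ i)"
    by (simp only: Suc.IH T_def)
  finally have "(\<Sum>k\<le>Suc n. T (Suc n) k) = (\<Prod>i<n. x + y * Q ^ i) * (x + y * Q ^ n)"
    by (simp only: distrib_left distrib_right mult_ac)
  then show ?case
    by (simp only: T_def prod.lessThan_Suc)
qed

text \<open>Division-free quotient formula for Gaussian coefficients. Both terms of the recurrence
  become multiples of the product up to \<open>n\<close>, and
  \<open>(1 - Q^(n-l)) + Q^(n-l) (1 - Q^(l+1)) = 1 - Q^(n+1)\<close>.\<close>

lemma qbinomial_mult_prods:
  fixes Q :: "'a::comm_ring_1"
  assumes "k \<le> n"
  shows "qbinomial Q n k * (\<Prod>i<k. 1 - Q ^ Suc i) * (\<Prod>i<n - k. 1 - Q ^ Suc i)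
    = (\<Prod>i<n. 1 - Q ^ Suc i)"
  using assms
proof (induction n arbitrary: k)
  case 0
  then show ?case by simp
next
  case (Suc n)
  let ?p = "\<lambda>k. \<Prod>i<k. 1 - Q ^ Suc i"
  show ?case
  proof (cases k)
    case 0
    then show ?thesis by simp
  next
    case [simp]: (Suc l)
    with Suc.prems have "l \<le> n" by simp
    have IH: "qbinomial Q n l * ?p l * ?p (n - l) = ?p n"
      using Suc.IH[OF \<open>l \<le> n\<close>] .
    have 1: "qbinomial Q n (Suc l) * ?p (Suc l) * ?p (n - l) = (1 - Q ^ (n - l)) * ?p n"
    proof (cases "l = n")
      case True
      then show ?thesis by (simp add: qbinomial_eq_0)
    next
      case False
      with \<open>l \<le> n\<close> have "Suc l \<le> n" "n - l = Suc (n - Suc l)" by simp_all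
      then have "qbinomial Q n (Suc l) * ?p (Suc l) * ?p (n - l)
          = (1 - Q ^ (n - l)) * (qbinomial Q n (Suc l) * ?p (Suc l) * ?p (n - Suc l))"
        by (simp only: prod.lessThan_Suc mult_ac)
      then show ?thesis
        unfolding Suc.IH[OF \<open>Suc l \<le> n\<close>] .
    qed
    have 2: "qbinomial Q n l * ?p (Suc l) * ?p (n - l) = (1 - Q ^ Suc l) * ?p n"
      unfolding IH[symmetric] by (simp only: prod.lessThan_Suc mult_ac)
    have "qbinomial Q (Suc n) (Suc l) * ?p (Suc l) * ?p (n - l)
        = qbinomial Q n (Suc l) * ?p (Suc l) * ?p (n - l)
          + Q ^ (n - l) * (qbinomial Q n l * ?p (Suc l) * ?p (n - l))"
      by (simp only: qbinomial.simps algebra_simps)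
    also have "\<dots> = (1 - Q ^ (n - l) * Q ^ Suc l) * ?p n"
      unfolding 1 2 by (simp add: algebra_simps)
    also have "Q ^ (n - l) * Q ^ Suc l = Q ^ Suc n"
      using \<open>l \<le> n\<close> by (simp only: power_add[symmetric]) simp
    finally show ?thesis
      by (simp add: mult.commute del: qbinomial.simps)
  qed
qed

subsection \<open>Formal power series in the \<open>X\<close>-adic topology\<close>

lemma fps_X_power_dvd_iff:
  fixes F :: "'a::comm_ring_1 fps"
  shows "fps_X ^ n dvd F \<longleftrightarrow> (\<forall>i<n. fps_nth F i = 0)"
proof
  assume "fps_X ^ n dvd F"
  then obtain G where "F = fps_X ^ n * G" by (elim dvdE)
  then show "\<forall>i<n. fps_nth F i = 0" by (simp add: fps_X_power_mult_nth)
next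
  assume "\<forall>i<n. fps_nth F i = 0"
  then have "F = fps_X ^ n * fps_shift n F"
    by (auto simp: fps_eq_iff fps_X_power_mult_nth)
  then show "fps_X ^ n dvd F" by (metis dvd_triv_left)
qed

lemma fps_X_power_dvd_mult_cancel:
  fixes F G :: "'a::idom fps"
  assumes "fps_X ^ n dvd F * G" "fps_nth F 0 = 1"
  shows "fps_X ^ n dvd G"
  unfolding fps_X_power_dvd_iff
proof (intro allI impI)
  fix i assume "i < n"
  then show "fps_nth G i = 0"
  proof (induction i rule: less_induct)
    case (less i)
    have "fps_nth (F * G) i = (\<Sum>j=0..i. fps_nth F j * fps_nth G (i - j))"
      by (rule fps_mult_nth)
    also have "\<dots> = (\<Sum>j=0..i. if j = 0 then fps_nth G i else 0)"
      using less assms(2) by (intro sum.cong) auto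
    finally show ?case
      using assms(1) less.prems by (simp add: fps_X_power_dvd_iff)
  qed
qed

lemma tendsto_mult_fps:
  fixes F G :: "'b \<Rightarrow> 'a::comm_ring_1 fps"
  assumes "(F \<longlongrightarrow> F') A" "(G \<longlongrightarrow> G') A"
  shows "((\<lambda>x. F x * G x) \<longlongrightarrow> F' * G') A"
proof (rule tendsto_fpsI)
  fix n
  have "eventually (\<lambda>x. \<forall>i\<in>{0..n}. fps_nth (F x) i = fps_nth F' i) A"
    using assms(1) by (subst eventually_ball_finite_distrib) (auto simp: tendsto_fps_iff)
  moreover have "eventually (\<lambda>x. \<forall>i\<in>{0..n}. fps_nth (G x) i = fps_nth G' i) A"
    using assms(2) by (subst eventually_ball_finite_distrib) (auto simp: tendsto_fps_iff)
  ultimately show "eventually (\<lambda>x. fps_nth (F x * G x) n = fps_nth (F' * G') n) A"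
    by eventually_elim (auto simp: fps_mult_nth intro!: sum.cong)
qed

lemma tendsto_power_fps:
  fixes F :: "'b \<Rightarrow> 'a::comm_ring_1 fps"
  assumes "(F \<longlongrightarrow> F') A"
  shows "((\<lambda>x. F x ^ k) \<longlongrightarrow> F' ^ k) A"
  by (induction k) (auto intro: tendsto_mult_fps assms)

lemma tendsto_compose_fps:
  fixes F :: "'b \<Rightarrow> 'a::comm_ring_1 fps"
  assumes "(F \<longlongrightarrow> F') A"
  shows "((\<lambda>x. fps_compose (F x) c) \<longlongrightarrow> fps_compose F' c) A"
proof (rule tendsto_fpsI)
  fix n
  have "eventually (\<lambda>x. \<forall>i\<in>{0..n}. fps_nth (F x) i = fps_nth F' i) A"
    using assms by (subst eventually_ball_finite_distrib) (auto simp: tendsto_fps_iff)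
  then show "eventually (\<lambda>x. fps_nth (F x oo c) n = fps_nth (F' oo c) n) A"
    by eventually_elim (auto simp: fps_compose_nth intro!: sum.cong)
qed

subsection \<open>Euler's product\<close>

text \<open>\<open>dilate k F\<close> is \<open>F(q^k)\<close>, and \<open>dilate k euler\<close> is the product written \<open>fk\<close> in the
  theory of partitions.\<close>

definition dilate :: "nat \<Rightarrow> int fps \<Rightarrow> int fps" where
  "dilate k F = F oo fps_X ^ k"

text \<open>The q-Pochhammer symbol \<open>(q^c; q^c)_n\<close>.\<close>

definition qfactorial :: "nat \<Rightarrow> nat \<Rightarrow> int fps" where
  "qfactorial c n = (\<Prod>i<n. 1 - fps_X ^ (c * Suc i))"

text \<open>Coefficients of index at most \<open>n\<close> no longer change after \<open>n\<close>
  factors, so this diagonal is the infinite product.\<close>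

definition euler :: "int fps" where
  "euler = Abs_fps (\<lambda>n. fps_nth (qfactorial 1 n) n)"

lemma fps_nth_dilate:
  assumes "k > 0"
  shows "fps_nth (dilate k F) n = (if k dvd n then fps_nth F (n div k) else 0)"
proof -
  have "fps_nth (dilate k F) n = (\<Sum>i=0..n. fps_nth F i * fps_nth (fps_X ^ (k * i)) n)"
    by (simp add: dilate_def fps_compose_nth power_mult)
  also have "\<dots> = (\<Sum>i=0..n. if i = n div k then (if k dvd n then fps_nth F (n div k) else 0) else 0)"
    using assms by (intro sum.cong) (auto simp: fps_X_power_nth)
  also have "\<dots> = (if k dvd n then fps_nth F (n div k) else 0)"
    by simp
  finally show ?thesis .
qed

context
  fixes k :: nat
  assumes k: "k > 0"
begin

lemma dilate_mult: "dilate k (F * G) = dilate k F * dilate k G"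
  using k by (simp add: dilate_def fps_compose_mult_distrib)

lemma dilate_power: "dilate k (F ^ n) = dilate k F ^ n"
  using k by (simp add: dilate_def fps_compose_power)

lemma dilate_X_power: "dilate k (fps_X ^ n) = fps_X ^ (k * n)"
  using k by (simp add: dilate_def fps_X_power_compose power_mult)

lemma dilate_prod: "dilate k (prod F S) = (\<Prod>i\<in>S. dilate k (F i))"
  using k by (simp add: dilate_def fps_compose_prod_distrib)

lemma dilate_dilate: "l > 0 \<Longrightarrow> dilate k (dilate l F) = dilate (k * l) F"
  using k by (simp add: dilate_def fps_compose_assoc[symmetric] fps_X_power_compose power_mult)

end

lemma dilate_add: "dilate k (F + G) = dilate k F + dilate k G"
  and dilate_diff: "dilate k (F - G) = dilate k F - dilate k G"
  and dilate_1: "dilate k 1 = 1"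
  and dilate_numeral: "dilate k (numeral m) = numeral m"
  and dilate_one: "dilate 1 F = F"
  by (simp_all add: dilate_def fps_compose_add_distrib fps_compose_sub_distrib)

lemma dilate_qfactorial: "k > 0 \<Longrightarrow> dilate k (qfactorial c n) = qfactorial (k * c) n"
  by (simp add: qfactorial_def dilate_prod dilate_diff dilate_1 dilate_X_power mult.assoc
      del: mult_Suc_right power_Suc)

lemma qfactorial_Suc: "qfactorial c (Suc n) = qfactorial c n * (1 - fps_X ^ (c * Suc n))"
  by (simp add: qfactorial_def)

lemma qfactorial_0: "qfactorial c 0 = 1"
  by (simp add: qfactorial_def)

lemma qfactorial_stable:
  assumes "c > 0" "n \<le> N" "i \<le> n"
  shows "fps_nth (qfactorial c N) i = fps_nth (qfactorial c n) i"
  using assms(2)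
proof (induction N rule: dec_induct)
  case base
  show ?case ..
next
  case (step N)
  have "Suc N \<le> c * Suc N" using assms(1) by (cases c) auto
  then have "i < c * Suc N"
    using assms step by linarith
  then show ?case
    using step.IH by (simp add: qfactorial_Suc right_diff_distrib fps_X_power_mult_right_nth)
qed

lemma fps_nth_euler: "n \<le> N \<Longrightarrow> fps_nth euler n = fps_nth (qfactorial 1 N) n"
  by (simp add: euler_def qfactorial_stable)

lemma qfactorial_tendsto_euler: "qfactorial 1 \<longlonglongrightarrow> euler"
proof (rule tendsto_fpsI)
  show "eventually (\<lambda>N. fps_nth (qfactorial 1 N) n = fps_nth euler n) sequentially" for n
    using eventually_ge_at_top[of n] by eventually_elim (simp add: fps_nth_euler)
qed

lemma qfactorial_tendsto:
  assumes "c > 0"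
  shows "qfactorial c \<longlonglongrightarrow> dilate c euler"
  using tendsto_compose_fps[OF qfactorial_tendsto_euler, of "fps_X ^ c"]
    dilate_qfactorial[OF assms, of 1]
  by (simp add: dilate_def)

lemma fps_nth_euler_0 [simp]: "fps_nth euler 0 = 1"
  by (simp add: euler_def qfactorial_0)

lemma fps_nth_dilate_0 [simp]: "fps_nth (dilate k F) 0 = fps_nth F 0"
  by (simp add: dilate_def)

lemma qfactorial_cong_euler:
  assumes "c > 0" "n \<le> N"
  shows "fps_X ^ n dvd qfactorial c N - dilate c euler"
  unfolding fps_X_power_dvd_iff
proof (intro allI impI)
  fix i assume "i < n"
  have "eventually (\<lambda>M. fps_nth (qfactorial c M) i = fps_nth (dilate c euler) i) sequentially"
    using qfactorial_tendsto[OF assms(1)] by (simp add: tendsto_fps_iff)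
  then obtain M where "\<And>m. m \<ge> M \<Longrightarrow> fps_nth (qfactorial c m) i = fps_nth (dilate c euler) i"
    by (auto simp: eventually_sequentially)
  then have "fps_nth (qfactorial c (max M N)) i = fps_nth (dilate c euler) i"
    by simp
  moreover have "fps_nth (qfactorial c (max M N)) i = fps_nth (qfactorial c N) i"
    using assms \<open>i < n\<close> by (intro qfactorial_stable) auto
  ultimately show "fps_nth (qfactorial c N - dilate c euler) i = 0"
    by simp
qed

text \<open>In \<open>B (Q)_k (Q)_(n-k) = (Q)_n\<close> all three symbols agree with the infinite
  product \<open>f\<close> modulo \<open>fps_X ^ m\<close>. This gives
  \<open>f (f B - 1) = 0\<close> modulo that power, and \<open>f\<close>, having constant term 1,
  can be cancelled.\<close>

lemma qbinomial_cong_euler: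
  assumes "c > 0" "m \<le> k" "m + k \<le> n"
  shows "fps_X ^ m dvd dilate c euler * qbinomial (fps_X ^ c) n k - 1"
proof -
  define f where "f = dilate c euler"
  define B :: "int fps" where "B = qbinomial (fps_X ^ c) n k"
  have "B * qfactorial c k * qfactorial c (n - k) = qfactorial c n"
    using qbinomial_mult_prods[of k n "fps_X ^ c :: int fps"] assms
    by (simp add: B_def qfactorial_def flip: power_mult del: power_Suc mult_Suc_right)
  moreover have "fps_X ^ m dvd qfactorial c k - f" "fps_X ^ m dvd qfactorial c (n - k) - f"
      "fps_X ^ m dvd qfactorial c n - f"
    unfolding f_def using assms by (simp_all add: qfactorial_cong_euler)
  then obtain a b d where "qfactorial c k = f + fps_X ^ m * a"
      "qfactorial c (n - k) = f + fps_X ^ m * b" "qfactorial c n = f + fps_X ^ m * d"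
    unfolding dvd_def by (metis add_diff_cancel_left' diff_add_cancel add.commute)
  ultimately have "f * (f * B - 1) = fps_X ^ m * (d - a * B * (f + fps_X ^ m * b) - b * B * f)"
    by (simp add: algebra_simps)
  then have "fps_X ^ m dvd f * (f * B - 1)" by (metis dvd_triv_left)
  then show ?thesis
    unfolding f_def[symmetric] B_def[symmetric]
    by (rule fps_X_power_dvd_mult_cancel) (simp add: f_def)
qed

subsection \<open>The Jacobi triple product\<close>

definition theta_exponent :: "nat \<Rightarrow> nat \<Rightarrow> int \<Rightarrow> int" where
  "theta_exponent c a j = int c * (j * (j - 1) div 2) + int a * j"

text \<open>Parameters 2, 1, 1 give Ramanujan's phi; 1, 1, 1 give twice his psi, as \<open>j\<close>
  and \<open>-1 - j\<close> share a triangular number; 3, 1, -1 give the pentagonal series. For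
  \<epsilon> = 1 or -1 the exponent \<open>nat \<bar>j\<bar>\<close> merely records the parity of
  \<open>j\<close>.\<close>

definition theta :: "nat \<Rightarrow> nat \<Rightarrow> int \<Rightarrow> int fps" where
  "theta c a \<epsilon> = Abs_fps (\<lambda>n. \<Sum>j | theta_exponent c a j = int n. \<epsilon> ^ nat \<bar>j\<bar>)"

definition theta_prod :: "nat \<Rightarrow> nat \<Rightarrow> int \<Rightarrow> nat \<Rightarrow> int fps" where
  "theta_prod c a \<epsilon> n = (\<Prod>i<n. (1 + fps_const \<epsilon> * fps_X ^ (c * i + a))
     * (1 + fps_const \<epsilon> * fps_X ^ (c * Suc i - a)))"

lemma two_times_triangle: "2 * (j * (j - 1) div 2) = j * (j - 1)" for j :: int
  by simp

text \<open>Only finitely many \<open>j\<close> reach a given coefficient, with an explicit bound.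
  For negative \<open>j\<close> the condition \<open>a \<le> c\<close> reduces the claim to the
  triangular exponent \<open>c j (j + 1) / 2\<close>.\<close>

lemma theta_exponent_ge:
  assumes "c > 0" "a \<le> c"
  shows "\<bar>j\<bar> - 1 \<le> theta_exponent c a j" "0 \<le> theta_exponent c a j"
proof -
  define g where "g = j * (j - 1) div 2"
  have g: "2 * g = j * (j - 1)" unfolding g_def by (rule two_times_triangle)
  have e: "theta_exponent c a j = int c * g + int a * j"
    by (simp add: theta_exponent_def g_def)
  have "\<bar>j\<bar> - 1 \<le> theta_exponent c a j \<and> 0 \<le> theta_exponent c a j"
  proof (cases "j > 0")
    case True
    have "0 \<le> (j - 1) * (j - 2)"
      using True by (cases "j = 1") auto
    then have "j - 1 \<le> g"
      using g by (simp add: algebra_simps)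
    moreover have "g \<le> int c * g"
      using \<open>j - 1 \<le> g\<close> True assms(1) mult_right_mono[of 1 "int c" g] by simp
    ultimately show ?thesis
      using True unfolding e by (simp add: add_increasing2)
  next
    case False
    have "0 \<le> (- j - 1) * (- j) \<and> 0 \<le> (- j - 1) * (- j - 2)" if "j \<noteq> 0"
      using that False mult_nonneg_nonneg[of "- j - 1" "- j"] mult_nonneg_nonneg[of "- j - 1" "- j - 2"]
      by (cases "j = -1") auto
    then have g': "- j - 1 \<le> g + j \<and> 0 \<le> g + j"
      using g by (cases "j = 0") (auto simp: algebra_simps)
    moreover have "g + j \<le> int c * (g + j)"
      using g' assms(1) mult_right_mono[of 1 "int c" "g + j"] by simp
    moreover have "int c * j \<le> int a * j"
      using False assms(2) by (intro mult_right_mono_neg) auto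
    ultimately show ?thesis
      using False unfolding e by (simp add: algebra_simps)
  qed
  then show "\<bar>j\<bar> - 1 \<le> theta_exponent c a j" "0 \<le> theta_exponent c a j"
    by auto
qed

lemma prod_power_rev: "(\<Prod>i<n. Q ^ (n - Suc i)) = (Q :: 'a::comm_ring_1) ^ (n choose 2)"
proof -
  have "(\<Prod>i<n. Q ^ (n - Suc i)) = (\<Prod>i<n. Q ^ i)"
    by (rule prod.nat_diff_reindex)
  also have "\<dots> = Q ^ (n choose 2)"
    by (induction n) (simp_all add: Suc_choose_two power_add binomial_eq_0 mult.commute)
  finally show ?thesis .
qed

text \<open>The finite form of the Jacobi triple product: take \<open>x = Q ^ n\<close> in the
  \<open>q\<close>-binomial theorem for an even number of factors and cancel a monomial.\<close>

lemma theta_prod_eq_sum: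
  assumes "c > 0" "a \<le> c" "\<epsilon> * \<epsilon> = 1"
  shows "theta_prod c a \<epsilon> n = (\<Sum>k\<le>2*n. fps_const (\<epsilon> ^ nat \<bar>int k - int n\<bar>)
    * qbinomial (fps_X ^ c) (2 * n) k * fps_X ^ nat (theta_exponent c a (int k - int n)))"
proof -
  define Q :: "int fps" where "Q = fps_X ^ c"
  define z :: "int fps" where "z = fps_const \<epsilon> * fps_X ^ a"
  \<comment> \<open>The monomial to be cancelled: the lower half of the factors, read backwards,
    yields \<open>Q ^ (n choose 2) * z ^ n\<close>, the upper half
    \<open>Q ^ (n * n)\<close>.\<close>
  define K where "K = Q ^ (n choose 2) * z ^ n * Q ^ (n * n)"
  have "{..<2*n} = {..<n} \<union> (+) n ` {..<n}"
  proof (intro equalityI subsetI)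
    fix x assume "x \<in> {..<2*n}"
    then show "x \<in> {..<n} \<union> (+) n ` {..<n}"
      by (cases "x < n") (auto simp: image_iff intro: bexI[of _ "x - n"])
  qed auto
  then have "(\<Prod>i<2*n. Q ^ n + z * Q ^ i) = (\<Prod>i\<in>{..<n} \<union> (+) n ` {..<n}. Q ^ n + z * Q ^ i)"
    by simp
  also have "\<dots> = (\<Prod>i<n. Q ^ n + z * Q ^ i) * (\<Prod>i\<in>(+) n ` {..<n}. Q ^ n + z * Q ^ i)"
    by (rule prod.union_disjoint) auto
  also have "(\<Prod>i\<in>(+) n ` {..<n}. Q ^ n + z * Q ^ i) = (\<Prod>i<n. Q ^ n + z * Q ^ (n + i))"
    by (subst prod.reindex) auto
  also have "(\<Prod>i<n. Q ^ n + z * Q ^ i) = (\<Prod>i<n. Q ^ n + z * Q ^ (n - Suc i))"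
    by (rule prod.nat_diff_reindex[symmetric])
  also have "(\<Prod>i<n. Q ^ n + z * Q ^ (n - Suc i))
      = (\<Prod>i<n. Q ^ (n - Suc i) * z * (1 + fps_const \<epsilon> * fps_X ^ (c * Suc i - a)))"
  proof (rule prod.cong)
    fix i assume "i \<in> {..<n}"
    then have "n = (n - Suc i) + Suc i" by simp
    then have "Q ^ n = Q ^ (n - Suc i) * Q ^ Suc i"
      by (metis power_add)
    moreover have "Q ^ Suc i = z * (fps_const \<epsilon> * fps_X ^ (c * Suc i - a))"
    proof -
      have "z * (fps_const \<epsilon> * fps_X ^ (c * Suc i - a))
          = fps_const (\<epsilon> * \<epsilon>) * fps_X ^ (a + (c * Suc i - a))"
        by (simp only: z_def power_add fps_const_mult[symmetric] mult_ac)
      also have "a + (c * Suc i - a) = c * Suc i"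
        using assms(2) by simp
      finally show ?thesis
        using assms(3) by (simp only: Q_def power_mult) simp
    qed
    ultimately show "Q ^ n + z * Q ^ (n - Suc i)
        = Q ^ (n - Suc i) * z * (1 + fps_const \<epsilon> * fps_X ^ (c * Suc i - a))"
      by (simp only: distrib_left mult_1_right mult_1_left mult_ac add.commute)
  qed simp
  also have "(\<Prod>i<n. Q ^ n + z * Q ^ (n + i)) = (\<Prod>i<n. Q ^ n * (1 + fps_const \<epsilon> * fps_X ^ (c * i + a)))"
  proof (intro prod.cong refl)
    fix i
    have "fps_X ^ (c * i + a) = Q ^ i * fps_X ^ a"
      by (simp add: Q_def power_add power_mult)
    then show "Q ^ n + z * Q ^ (n + i) = Q ^ n * (1 + fps_const \<epsilon> * fps_X ^ (c * i + a))"
      by (simp add: z_def power_add algebra_simps)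
  qed
  also have "(\<Prod>i<n. Q ^ (n - Suc i) * z * (1 + fps_const \<epsilon> * fps_X ^ (c * Suc i - a)))
      * (\<Prod>i<n. Q ^ n * (1 + fps_const \<epsilon> * fps_X ^ (c * i + a))) = K * theta_prod c a \<epsilon> n"
    by (simp add: prod.distrib prod_power_rev K_def theta_prod_def power_mult mult_ac)
  finally have lhs: "(\<Prod>i<2*n. Q ^ n + z * Q ^ i) = K * theta_prod c a \<epsilon> n" .

  have K: "K = fps_const (\<epsilon> ^ n) * fps_X ^ (c * (n choose 2) + a * n + c * (n * n))"
    by (simp add: K_def Q_def z_def power_mult_distrib power_add power_mult mult_ac
        flip: fps_const_power)
  have rhs: "Q ^ (k choose 2) * qbinomial Q (2 * n) k * z ^ k * (Q ^ n) ^ (2 * n - k)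
      = K * (fps_const (\<epsilon> ^ nat \<bar>int k - int n\<bar>) * qbinomial Q (2 * n) k
          * fps_X ^ nat (theta_exponent c a (int k - int n)))"
    if "k \<le> 2 * n" for k
  proof -
    define j where "j = int k - int n"
    define g where "g = j * (j - 1) div 2"
    have tri: "2 * int (m choose 2) = int m * (int m - 1)" for m :: nat
      by (induction m) (simp_all add: Suc_choose_two binomial_eq_0 algebra_simps)
    have e: "int (nat (theta_exponent c a j)) = int c * g + int a * j"
      using theta_exponent_ge(2)[OF assms(1,2)] by (simp add: theta_exponent_def g_def)
    have "2 * g = j * (j - 1)"
      unfolding g_def by (rule two_times_triangle)
    then have "2 * (int (k choose 2) + int n * (2 * int n - int k))
        = 2 * (int (n choose 2) + int n * int n + g)"
      unfolding distrib_left tri by (simp add: j_def algebra_simps)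
    then have sum: "int (k choose 2) + int n * (2 * int n - int k)
        = int (n choose 2) + int n * int n + g"
      by simp
    have "int c * (int (k choose 2) + int n * (2 * int n - int k)) + int a * int k
        = int c * (int (n choose 2) + int n * int n) + int a * int n + (int c * g + int a * j)"
      unfolding sum by (simp add: j_def algebra_simps)
    also have "2 * int n - int k = int (2 * n - k)"
      using that by simp
    finally have "int (c * (k choose 2) + a * k + c * n * (2 * n - k))
        = int (c * (n choose 2) + a * n + c * (n * n) + nat (theta_exponent c a j))"
      by (simp only: e of_nat_add of_nat_mult) (simp only: algebra_simps)
    then have expo: "c * (k choose 2) + a * k + c * n * (2 * n - k)
        = c * (n choose 2) + a * n + c * (n * n) + nat (theta_exponent c a j)"
      by (simp only: of_nat_eq_iff)
    have "even (n + nat \<bar>j\<bar>) = even k"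
      unfolding j_def by (simp add: even_nat_iff) blast
    moreover have "\<epsilon> = 1 \<or> \<epsilon> = -1"
      using assms(3) by (simp add: zmult_eq_1_iff)
    ultimately have sgn: "\<epsilon> ^ k = \<epsilon> ^ n * \<epsilon> ^ nat \<bar>j\<bar>"
      unfolding power_add[symmetric] by (elim disjE) (simp_all add: minus_one_power_iff del: even_add)
    have "Q ^ (k choose 2) * qbinomial Q (2 * n) k * z ^ k * (Q ^ n) ^ (2 * n - k)
        = fps_const (\<epsilon> ^ k) * qbinomial Q (2 * n) k * fps_X ^ (c * (k choose 2) + a * k + c * n * (2 * n - k))"
      by (simp add: Q_def z_def power_mult_distrib power_add power_mult mult_ac flip: fps_const_power)
    also have "\<dots> = K * (fps_const (\<epsilon> ^ nat \<bar>j\<bar>) * qbinomial Q (2 * n) k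
          * fps_X ^ nat (theta_exponent c a j))"
      unfolding expo sgn K by (simp only: power_add fps_const_mult[symmetric] mult_ac)
    finally show ?thesis
      unfolding j_def .
  qed
  have "K * theta_prod c a \<epsilon> n = K * (\<Sum>k\<le>2*n. fps_const (\<epsilon> ^ nat \<bar>int k - int n\<bar>)
      * qbinomial Q (2 * n) k * fps_X ^ nat (theta_exponent c a (int k - int n)))"
    unfolding lhs[symmetric] qbinomial_theorem sum_distrib_left
    by (intro sum.cong refl rhs) simp
  moreover have "\<epsilon> \<noteq> 0" using assms(3) by auto
  then have "K \<noteq> 0" unfolding K by simp
  ultimately show ?thesis
    unfolding Q_def by simp
qed

theorem Jacobi_triple_product:
  assumes "c > 0" "a \<le> c" "\<epsilon> * \<epsilon> = 1"
  shows "(\<lambda>n. dilate c euler * theta_prod c a \<epsilon> n) \<longlonglongrightarrow> theta c a \<epsilon>"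
proof (rule tendsto_fpsI)
  fix m :: nat
  define e where "e = theta_exponent c a"
  define f where "f = dilate c euler"
  have e_ge: "\<bar>j\<bar> - 1 \<le> e j" "0 \<le> e j" for j
    unfolding e_def using theta_exponent_ge[OF assms(1,2)] by auto
  \<comment> \<open>Coefficient \<open>m\<close> involves only \<bar>j\<bar> \<le> m + 1. For
    \<open>n \<ge> 2 * m + 2\<close> the index \<open>k = n + j\<close> is then at distance at least
    \<open>m + 1\<close> from both ends \<open>0\<close> and \<open>2 * n\<close>, so
    \<open>f\<close> times the Gaussian coefficient is 1 up to degree \<open>m\<close>.\<close>
  have "fps_nth (f * theta_prod c a \<epsilon> n) m = fps_nth (theta c a \<epsilon>) m" if "n \<ge> 2 * m + 2" for n
  proof -
    have summand: "fps_nth (f * (fps_const (\<epsilon> ^ nat \<bar>j\<bar>) * qbinomial (fps_X ^ c) (2 * n) k * fps_X ^ nat (e j))) m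
        = (if e j = int m then \<epsilon> ^ nat \<bar>j\<bar> else 0)"
      if "j = int k - int n" "k \<le> 2 * n" for j k
    proof (cases "e j \<le> int m")
      case True
      then have "\<bar>j\<bar> \<le> int m + 1" using e_ge(1)[of j] by linarith
      then have "fps_X ^ Suc m dvd f * qbinomial (fps_X ^ c) (2 * n) k - 1"
        unfolding f_def using \<open>n \<ge> 2 * m + 2\<close> that assms(1)
        by (intro qbinomial_cong_euler) auto
      then have "fps_nth (f * qbinomial (fps_X ^ c) (2 * n) k) (m - nat (e j))
          = fps_nth 1 (m - nat (e j))"
        unfolding fps_X_power_dvd_iff by simp
      then have "fps_nth (fps_const (\<epsilon> ^ nat \<bar>j\<bar>) * (f * qbinomial (fps_X ^ c) (2 * n) k * fps_X ^ nat (e j))) m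
          = (if e j = int m then \<epsilon> ^ nat \<bar>j\<bar> else 0)"
        using True e_ge(2)[of j] by (auto simp: fps_X_power_mult_right_nth)
      then show ?thesis by (simp only: mult_ac)
    next
      case False
      then have "fps_nth (fps_const (\<epsilon> ^ nat \<bar>j\<bar>) * (f * qbinomial (fps_X ^ c) (2 * n) k * fps_X ^ nat (e j))) m = 0"
        by (simp add: fps_X_power_mult_right_nth)
      with False show ?thesis by (simp only: mult_ac) simp
    qed
    have "fps_nth (f * theta_prod c a \<epsilon> n) m
        = (\<Sum>k\<le>2*n. if e (int k - int n) = int m then \<epsilon> ^ nat \<bar>int k - int n\<bar> else 0)"
      unfolding theta_prod_eq_sum[OF assms] sum_distrib_left fps_sum_nth e_def[symmetric]
      by (intro sum.cong refl summand) simp_all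
    also have "\<dots> = (\<Sum>j\<in>{- int n..int n}. if e j = int m then \<epsilon> ^ nat \<bar>j\<bar> else 0)"
      by (rule sum.reindex_bij_witness[of _ "\<lambda>j. nat (j + int n)" "\<lambda>k. int k - int n"]) auto
    also have "\<dots> = (\<Sum>j\<in>{j\<in>{- int n..int n}. e j = int m}. \<epsilon> ^ nat \<bar>j\<bar>)"
      by (rule sum.inter_filter[symmetric]) simp
    also have "{j\<in>{- int n..int n}. e j = int m} = {j. e j = int m}"
    proof (intro equalityI subsetI CollectI)
      fix j assume "j \<in> {j. e j = int m}"
      then have j: "e j = int m" by simp
      then have "\<bar>j\<bar> \<le> int m + 1" using e_ge(1)[of j] by simp
      with j that show "j \<in> {- int n..int n} \<and> e j = int m" by auto
    qed auto
    finally show ?thesis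
      by (simp add: theta_def e_def)
  qed
  then show "eventually (\<lambda>n. fps_nth (dilate c euler * theta_prod c a \<epsilon> n) m = fps_nth (theta c a \<epsilon>) m) sequentially"
    unfolding f_def eventually_sequentially by blast
qed

subsection \<open>Theta functions as products\<close>

definition negate :: "int fps \<Rightarrow> int fps" where
  "negate F = fps_compose F (- fps_X)"

lemma fps_nth_negate: "fps_nth (negate F) n = (- 1) ^ n * fps_nth F n"
proof -
  have "fps_nth ((- fps_X) ^ i) n = (if i = n then (- 1 :: int) ^ n else 0)" for i
    by (cases "even i") (auto simp: fps_X_power_nth)
  then have "fps_nth (negate F) n = (\<Sum>i=0..n. if i = n then fps_nth F n * (- 1) ^ n else 0)"
    unfolding negate_def fps_compose_nth by (intro sum.cong) auto
  then show ?thesis by (simp add: mult.commute)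
qed

lemma negate_mult: "negate (F * G) = negate F * negate G"
  by (simp add: negate_def fps_compose_mult_distrib)

lemma negate_power: "negate (F ^ n) = negate F ^ n"
  by (simp add: negate_def fps_compose_power)

lemma negate_X_power: "negate (fps_X ^ n) = (- fps_X) ^ n"
  by (simp add: negate_def fps_X_power_compose)

lemma negate_1: "negate 1 = 1"
  and negate_diff: "negate (F - G) = negate F - negate G"
  and negate_add: "negate (F + G) = negate F + negate G"
  by (simp_all add: negate_def fps_compose_sub_distrib fps_compose_add_distrib)

lemma negate_dilate: "even k \<Longrightarrow> k > 0 \<Longrightarrow> negate (dilate k F) = dilate k F"
  by (auto simp: fps_eq_iff fps_nth_negate fps_nth_dilate)

lemma negate_qfactorial_Suc:
  "negate (qfactorial c (Suc n)) = negate (qfactorial c n) * (1 - (- fps_X) ^ (c * Suc n))"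
  by (simp only: qfactorial_Suc negate_mult negate_diff negate_1 negate_X_power)

lemma tendsto_negate: "(F \<longlongrightarrow> F') A \<Longrightarrow> ((\<lambda>x. negate (F x)) \<longlongrightarrow> negate F') A"
  unfolding negate_def by (rule tendsto_compose_fps)

lemma tendsto_qfactorial_mult:
  assumes "c > 0" "k > 0"
  shows "(\<lambda>n. qfactorial c (k * n)) \<longlonglongrightarrow> dilate c euler"
  using LIMSEQ_subseq_LIMSEQ[OF qfactorial_tendsto[OF assms(1)], of "\<lambda>n. k * n"] assms(2)
  by (simp add: o_def strict_mono_def)

lemma tendsto_qfactorial_1_mult:
  assumes "k > 0"
  shows "(\<lambda>n. qfactorial 1 (k * n)) \<longlonglongrightarrow> euler"
  using tendsto_qfactorial_mult[of 1 k] assms by (simp add: dilate_one[unfolded One_nat_def])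

lemma dilate_euler_nonzero: "dilate k euler \<noteq> 0"
  by (metis fps_nth_dilate_0 fps_nth_euler_0 fps_zero_nth zero_neq_one)

lemma euler_nonzero: "euler \<noteq> 0"
  by (metis fps_nth_euler_0 fps_zero_nth zero_neq_one)

text \<open>The numbers of factors are chosen such that the identity already holds for finite
  products: with \<open>x\<close>, \<open>y\<close> the next odd and even power of \<open>q\<close>,
  both sides gain \<open>(1 - x^2) (1 - y)^2 (1 - y^2)\<close>. The product formulas below are
  obtained in the same way.\<close>

lemma euler_mult_negate:
  "euler * negate euler * dilate 4 euler = dilate 2 euler ^ 3"
proof -
  have eq: "qfactorial 1 (2 * n) * negate (qfactorial 1 (2 * n)) * qfactorial 4 (1 * n)
      = qfactorial 2 (2 * n) * qfactorial 2 (1 * n) ^ 2" for n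
  proof (induction n)
    case 0
    then show ?case by (simp add: qfactorial_0 negate_1)
  next
    case (Suc n)
    define x :: "int fps" where "x = fps_X ^ (2 * n + 1)"
    define y :: "int fps" where "y = fps_X ^ (2 * n + 2)"
    have 1: "qfactorial 1 (2 * Suc n) = qfactorial 1 (2 * n) * (1 - x) * (1 - y)"
      by (simp add: qfactorial_Suc x_def y_def)
    have 2: "negate (qfactorial 1 (2 * Suc n)) = negate (qfactorial 1 (2 * n)) * (1 + x) * (1 - y)"
      by (simp add: negate_qfactorial_Suc x_def y_def)
    have 3: "qfactorial 4 (1 * Suc n) = qfactorial 4 (1 * n) * (1 - y ^ 2)"
      by (simp add: qfactorial_Suc y_def algebra_simps flip: power_mult power_Suc)
    have 4: "qfactorial 2 (2 * Suc n) = qfactorial 2 (2 * n) * (1 - x ^ 2) * (1 - y ^ 2)"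
      by (simp add: qfactorial_Suc x_def y_def algebra_simps flip: power_mult power_Suc)
    have 5: "qfactorial 2 (1 * Suc n) = qfactorial 2 (1 * n) * (1 - y)"
      by (simp add: qfactorial_Suc y_def)
    have "qfactorial 1 (2 * Suc n) * negate (qfactorial 1 (2 * Suc n)) * qfactorial 4 (1 * Suc n)
        = (qfactorial 1 (2 * n) * negate (qfactorial 1 (2 * n)) * qfactorial 4 (1 * n))
          * ((1 - x ^ 2) * (1 - y) ^ 2 * (1 - y ^ 2))"
      unfolding 2 unfolding 1 3 by algebra
    also have "\<dots> = qfactorial 2 (2 * Suc n) * qfactorial 2 (1 * Suc n) ^ 2"
      unfolding Suc.IH 4 5 by algebra
    finally show ?case .
  qed
  have "(\<lambda>n. qfactorial 1 (2 * n) * negate (qfactorial 1 (2 * n)) * qfactorial 4 (1 * n))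
      \<longlonglongrightarrow> euler * negate euler * dilate 4 euler"
    by (intro tendsto_mult_fps tendsto_negate tendsto_qfactorial_1_mult tendsto_qfactorial_mult) simp_all
  moreover have "(\<lambda>n. qfactorial 2 (2 * n) * qfactorial 2 (1 * n) ^ 2)
      \<longlonglongrightarrow> dilate 2 euler * dilate 2 euler ^ 2"
    by (intro tendsto_mult_fps tendsto_power_fps tendsto_qfactorial_mult) simp_all
  ultimately have "euler * negate euler * dilate 4 euler = dilate 2 euler * dilate 2 euler ^ 2"
    unfolding eq by (rule LIMSEQ_unique)
  then show ?thesis
    by (simp add: power3_eq_cube power2_eq_square mult.assoc)
qed

lemma theta_prod_0: "theta_prod c a \<epsilon> 0 = 1"
  and theta_prod_Suc: "theta_prod c a \<epsilon> (Suc n) = theta_prod c a \<epsilon> n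
     * ((1 + fps_const \<epsilon> * fps_X ^ (c * n + a)) * (1 + fps_const \<epsilon> * fps_X ^ (c * Suc n - a)))"
  by (simp_all add: theta_prod_def)

lemma theta_2_1_1_product: "theta 2 1 1 * dilate 2 euler = negate euler ^ 2"
proof -
  have eq: "theta_prod 2 1 1 n * qfactorial 2 (1 * n) ^ 2 = negate (qfactorial 1 (2 * n)) ^ 2" for n
  proof (induction n)
    case 0
    then show ?case by (simp add: qfactorial_0 negate_1 theta_prod_0)
  next
    case (Suc n)
    define x :: "int fps" where "x = fps_X ^ (2 * n + 1)"
    define y :: "int fps" where "y = fps_X ^ (2 * n + 2)"
    have 1: "negate (qfactorial 1 (2 * Suc n)) = negate (qfactorial 1 (2 * n)) * (1 + x) * (1 - y)"
      by (simp add: negate_qfactorial_Suc x_def y_def)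
    have 2: "qfactorial 2 (1 * Suc n) = qfactorial 2 (1 * n) * (1 - y)"
      by (simp add: qfactorial_Suc y_def)
    have 3: "theta_prod 2 1 1 (Suc n) = theta_prod 2 1 1 n * ((1 + x) * (1 + x))"
      by (simp add: theta_prod_Suc x_def)
    have "theta_prod 2 1 1 (Suc n) * qfactorial 2 (1 * Suc n) ^ 2
        = (theta_prod 2 1 1 n * qfactorial 2 (1 * n) ^ 2) * ((1 + x) * (1 - y)) ^ 2"
      unfolding 2 3 by algebra
    also have "\<dots> = negate (qfactorial 1 (2 * Suc n)) ^ 2"
      unfolding Suc.IH 1 by algebra
    finally show ?case .
  qed
  have "(\<lambda>n. dilate 2 euler * theta_prod 2 1 1 n * qfactorial 2 (1 * n) ^ 2)
      \<longlonglongrightarrow> theta 2 1 1 * dilate 2 euler ^ 2"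
    by (intro tendsto_mult_fps tendsto_power_fps tendsto_qfactorial_mult Jacobi_triple_product) simp_all
  moreover have "(\<lambda>n. dilate 2 euler * negate (qfactorial 1 (2 * n)) ^ 2)
      \<longlonglongrightarrow> dilate 2 euler * negate euler ^ 2"
    by (intro tendsto_mult_fps tendsto_power_fps tendsto_negate tendsto_qfactorial_1_mult tendsto_const) simp_all
  ultimately have "theta 2 1 1 * dilate 2 euler ^ 2 = dilate 2 euler * negate euler ^ 2"
    unfolding eq mult.assoc by (rule LIMSEQ_unique)
  then have "dilate 2 euler * (theta 2 1 1 * dilate 2 euler) = dilate 2 euler * negate euler ^ 2"
    by (simp only: power2_eq_square mult_ac)
  then show ?thesis
    using dilate_euler_nonzero by simp
qed

text \<open>The factor 2 is \<open>1 + q^0\<close>, present because \<open>a = c\<close>. Every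
  further \<open>1 + q^i\<close> occurs twice in \<open>theta_prod 1 1 1 n\<close> except the last;
  the auxiliary \<open>1 + fps_X ^ n\<close> supplies its partner and tends to 1.\<close>

lemma theta_1_1_1_product: "theta 1 1 1 * euler = 2 * dilate 2 euler ^ 2"
proof -
  have eq: "theta_prod 1 1 1 n * (1 + fps_X ^ n) * qfactorial 1 (1 * n) ^ 2
      = 2 * qfactorial 2 (1 * n) ^ 2" for n
  proof (induction n)
    case 0
    then show ?case by (simp add: qfactorial_0 theta_prod_0)
  next
    case (Suc n)
    define x :: "int fps" where "x = fps_X ^ n"
    define y :: "int fps" where "y = fps_X ^ Suc n"
    have 1: "qfactorial 1 (1 * Suc n) = qfactorial 1 (1 * n) * (1 - y)"
      by (simp add: qfactorial_Suc y_def)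
    have "y ^ 2 = fps_X ^ (2 * Suc n)"
      by (simp add: y_def mult.commute flip: power_mult power_Suc del: power_Suc mult_Suc_right mult_Suc)
    then have 2: "qfactorial 2 (1 * Suc n) = qfactorial 2 (1 * n) * (1 - y ^ 2)"
      by (simp add: qfactorial_Suc)
    have 3: "theta_prod 1 1 1 (Suc n) = theta_prod 1 1 1 n * ((1 + y) * (1 + x))"
      by (simp add: theta_prod_Suc x_def y_def)
    have "theta_prod 1 1 1 (Suc n) * (1 + y) * qfactorial 1 (1 * Suc n) ^ 2
        = (theta_prod 1 1 1 n * (1 + x) * qfactorial 1 (1 * n) ^ 2) * (1 - y ^ 2) ^ 2"
      unfolding 1 3 by algebra
    also have "theta_prod 1 1 1 n * (1 + x) * qfactorial 1 (1 * n) ^ 2 = 2 * qfactorial 2 (1 * n) ^ 2"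
      unfolding x_def by (rule Suc.IH)
    also have "2 * qfactorial 2 (1 * n) ^ 2 * (1 - y ^ 2) ^ 2 = 2 * qfactorial 2 (1 * Suc n) ^ 2"
      unfolding 2 by algebra
    finally show ?case unfolding y_def .
  qed
  have "(\<lambda>n. 1 + fps_X ^ n :: int fps) \<longlonglongrightarrow> 1"
  proof (rule tendsto_fpsI)
    show "eventually (\<lambda>n. fps_nth (1 + fps_X ^ n :: int fps) m = fps_nth 1 m) sequentially" for m
      using eventually_gt_at_top[of m] by eventually_elim simp
  qed
  moreover have "(\<lambda>n. euler * theta_prod 1 1 1 n) \<longlonglongrightarrow> theta 1 1 1"
    using Jacobi_triple_product[of 1 1 1] by (simp add: dilate_one[unfolded One_nat_def])
  ultimately have "(\<lambda>n. (euler * theta_prod 1 1 1 n) * (1 + fps_X ^ n) * qfactorial 1 (1 * n) ^ 2)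
      \<longlonglongrightarrow> theta 1 1 1 * 1 * euler ^ 2"
    by (intro tendsto_mult_fps tendsto_power_fps tendsto_qfactorial_1_mult) simp_all
  moreover have "(\<lambda>n. euler * (2 * qfactorial 2 (1 * n) ^ 2)) \<longlonglongrightarrow> euler * (2 * dilate 2 euler ^ 2)"
    by (intro tendsto_mult_fps tendsto_power_fps tendsto_qfactorial_mult tendsto_const) simp_all
  ultimately have "theta 1 1 1 * 1 * euler ^ 2 = euler * (2 * dilate 2 euler ^ 2)"
    unfolding eq[symmetric] mult.assoc by (rule LIMSEQ_unique)
  then have "euler * (theta 1 1 1 * euler) = euler * (2 * dilate 2 euler ^ 2)"
    by (simp add: power2_eq_square mult_ac)
  then show ?thesis
    using euler_nonzero by simp
qed

text \<open>Sort the factors \<open>1 - q^j\<close> by \<open>j\<close> modulo 3: the multiples of 3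
  form \<open>dilate 3 euler\<close>, which is cancelled at the end.\<close>

theorem pentagonal_number_theorem: "euler = theta 3 1 (- 1)"
proof -
  have eq: "theta_prod 3 1 (- 1) n * qfactorial 3 (1 * n) = qfactorial 1 (3 * n)" for n
  proof (induction n)
    case 0
    then show ?case by (simp add: qfactorial_0 theta_prod_0)
  next
    case (Suc n)
    define x :: "int fps" where "x = fps_X ^ (3 * n + 1)"
    define y :: "int fps" where "y = fps_X ^ (3 * n + 2)"
    define z :: "int fps" where "z = fps_X ^ (3 * n + 3)"
    have 1: "qfactorial 1 (3 * Suc n) = qfactorial 1 (3 * n) * (1 - x) * (1 - y) * (1 - z)"
      by (simp add: qfactorial_Suc x_def y_def z_def numeral_3_eq_3)
    have 2: "qfactorial 3 (1 * Suc n) = qfactorial 3 (1 * n) * (1 - z)"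
      by (simp add: qfactorial_Suc z_def)
    have "fps_const (- 1 :: int) = - 1"
      by (simp flip: fps_const_neg)
    moreover have "3 * Suc n - 1 = 3 * n + 2" by simp
    ultimately have 3: "theta_prod 3 1 (- 1) (Suc n) = theta_prod 3 1 (- 1) n * ((1 - x) * (1 - y))"
      unfolding theta_prod_Suc x_def y_def by simp
    have "theta_prod 3 1 (- 1) (Suc n) * qfactorial 3 (1 * Suc n)
        = (theta_prod 3 1 (- 1) n * qfactorial 3 (1 * n)) * ((1 - x) * (1 - y) * (1 - z))"
      unfolding 2 3 by (simp only: mult_ac)
    also have "\<dots> = qfactorial 1 (3 * Suc n)"
      unfolding Suc.IH 1 by (simp only: mult_ac)
    finally show ?case .
  qed
  have "(\<lambda>n. dilate 3 euler * theta_prod 3 1 (- 1) n * qfactorial 3 (1 * n))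
      \<longlonglongrightarrow> theta 3 1 (- 1) * dilate 3 euler"
    by (intro tendsto_mult_fps tendsto_qfactorial_mult Jacobi_triple_product) simp_all
  moreover have "(\<lambda>n. dilate 3 euler * qfactorial 1 (3 * n)) \<longlonglongrightarrow> dilate 3 euler * euler"
    by (intro tendsto_mult_fps tendsto_qfactorial_1_mult tendsto_const) simp_all
  ultimately have "theta 3 1 (- 1) * dilate 3 euler = dilate 3 euler * euler"
    unfolding eq mult.assoc by (rule LIMSEQ_unique)
  then show ?thesis
    using dilate_euler_nonzero[of 3] by (simp add: mult.commute)
qed

lemma fps_nth_euler_not_pentagonal:
  assumes "\<not> generalised_pentagonal (int n)"
  shows "fps_nth euler n = 0"
proof -
  have "theta_exponent 3 1 j = j * (3 * j - 1) div 2" for j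
  proof -
    have "2 * theta_exponent 3 1 j = 3 * (2 * (j * (j - 1) div 2)) + 2 * j"
      by (simp add: theta_exponent_def)
    also have "\<dots> = j * (3 * j - 1)"
      unfolding two_times_triangle by (simp add: algebra_simps)
    finally show ?thesis by simp
  qed
  then have none: "{j. theta_exponent 3 1 j = int n} = {}"
    using assms by (simp add: generalised_pentagonal_def eq_commute[of "int n"] del: One_nat_def)
  show ?thesis
    by (subst pentagonal_number_theorem) (simp add: theta_def none del: One_nat_def)
qed

section \<open>Classical relations between phi and psi, and Jacobi's identity\<close>

text \<open>Even squares are \<open>4 i^2\<close>, odd squares are
  \<open>8 i (i + 1) / 2 + 1\<close>; the coefficients on both sides count the corresponding
  \<open>i\<close>.\<close>

lemma theta_2_1_1_dissection:
  "theta 2 1 1 = dilate 4 (theta 2 1 1) + fps_X * dilate 8 (theta 1 1 1)"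
proof (rule fps_ext)
  fix n :: nat
  have sq: "theta_exponent 2 1 j = j * j" for j
    unfolding theta_exponent_def of_nat_numeral two_times_triangle by (simp add: algebra_simps)
  have phi: "fps_nth (theta 2 1 1) n = int (card {j. j * j = int n})" for n
    by (simp add: theta_def sq del: One_nat_def)
  have tri: "theta_exponent 1 1 i = int m \<longleftrightarrow> (2 * i + 1) * (2 * i + 1) = int (8 * m + 1)" for i m
  proof -
    define g where "g = i * (i - 1) div 2"
    have "(2 * i + 1) * (2 * i + 1) = 4 * (i * (i - 1)) + 8 * i + 1"
      by (simp add: algebra_simps)
    also have "i * (i - 1) = 2 * g"
      unfolding g_def by (rule two_times_triangle[symmetric])
    also have "4 * (2 * g) + 8 * i + 1 = 8 * theta_exponent 1 1 i + 1"
      by (simp add: theta_exponent_def g_def)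
    finally show ?thesis by auto
  qed
  have psi: "fps_nth (theta 1 1 1) m = int (card {i. (2 * i + 1) * (2 * i + 1) = int (8 * m + 1)})" for m
    unfolding theta_def fps_nth_Abs_fps tri by simp
  have odd_mod: "(2 * i + 1) * (2 * i + 1) mod 8 = 1" for i :: int
  proof -
    have "even (i * (i + 1))" by simp
    then obtain l where "i * (i + 1) = 2 * l" by (elim evenE)
    then have "(2 * i + 1) * (2 * i + 1) = 8 * l + 1" by (simp add: algebra_simps)
    then show ?thesis by simp
  qed
  consider "n mod 4 = 0" | "n mod 8 = 1" | "n mod 4 \<noteq> 0" "n mod 8 \<noteq> 1"
    by blast
  then show "fps_nth (theta 2 1 1) n
      = fps_nth (dilate 4 (theta 2 1 1) + fps_X * dilate 8 (theta 1 1 1)) n"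
  proof cases
    case 1
    define m where "m = n div 4"
    have 1: "n = 4 * m" using 1 by (auto simp: m_def)
    have "{j. j * j = int n} = (\<lambda>i. 2 * i) ` {i. i * i = int m}"
    proof (intro equalityI subsetI)
      fix j assume "j \<in> {j. j * j = int n}"
      then have j: "j * j = 4 * int m" by (simp add: 1)
      then have "even (j * j)" by simp
      then have "even j" by simp
      then obtain i where "j = 2 * i" by (elim evenE)
      with j show "j \<in> (\<lambda>i. 2 * i) ` {i. i * i = int m}" by auto
    qed (auto simp: 1)
    then have "card {j. j * j = int n} = card {i. i * i = int m}"
      by (simp add: card_image inj_on_def)
    moreover have "fps_nth (fps_X * dilate 8 (theta 1 1 1)) n = 0"
    proof -
      have "\<not> 8 dvd 4 * m - 1 \<or> m = 0" by presburger
      then show ?thesis by (auto simp: 1 fps_nth_dilate)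
    qed
    ultimately show ?thesis
      by (simp add: fps_nth_dilate phi 1 del: One_nat_def)
  next
    case 2
    define m where "m = n div 8"
    have 2: "n = 8 * m + 1" using div_mult_mod_eq[of n 8] 2 by (simp add: m_def)
    have "{j. j * j = int n} = (\<lambda>i. 2 * i + 1) ` {i. (2 * i + 1) * (2 * i + 1) = int (8 * m + 1)}"
    proof (intro equalityI subsetI)
      fix j assume "j \<in> {j. j * j = int n}"
      then have j: "j * j = 8 * int m + 1" by (simp add: 2)
      then have "odd (j * j)" by simp
      then have "odd j" by simp
      then obtain i where "j = 2 * i + 1" by (elim oddE)
      with j show "j \<in> (\<lambda>i. 2 * i + 1) ` {i. (2 * i + 1) * (2 * i + 1) = int (8 * m + 1)}"
        by auto
    qed (auto simp: 2)
    then have "card {j. j * j = int n} = card {i. (2 * i + 1) * (2 * i + 1) = int (8 * m + 1)}"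
      by (simp add: card_image inj_on_def)
    moreover have "\<not> 4 dvd n" unfolding 2 by presburger
    ultimately show ?thesis
      by (simp add: fps_nth_dilate phi psi 2 del: One_nat_def)
  next
    case 3
    have "j * j \<noteq> int n" for j
    proof
      assume j: "j * j = int n"
      show False
      proof (cases "even j")
        case True
        then obtain i where "j = 2 * i" by (elim evenE)
        then have "int n = 4 * (i * i)" using j by simp
        then have "int n mod 4 = 0" by simp
        then show False using 3(1) by presburger
      next
        case False
        then obtain i where "j = 2 * i + 1" by (elim oddE)
        then have "int n mod 8 = 1" using j odd_mod[of i] by simp
        then show False using 3(2) by presburger
      qed
    qed
    then have "{j. j * j = int n} = {}" by auto
    moreover have "\<not> 4 dvd n" "n = 0 \<or> \<not> 8 dvd n - 1"
      using 3 by presburger+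
    ultimately show ?thesis
      by (auto simp: fps_nth_dilate phi simp del: One_nat_def)
  qed
qed

lemma negate_theta_2_1_1_product: "negate (theta 2 1 1) * dilate 2 euler = euler ^ 2"
proof -
  have "negate (negate euler) = euler"
    by (simp add: fps_eq_iff fps_nth_negate flip: power_mult_distrib mult.assoc)
  then show ?thesis
    using arg_cong[OF theta_2_1_1_product, of negate]
    by (simp add: negate_mult negate_power negate_dilate)
qed

lemma negate_parts:
  assumes "even k" "k > 0" "even l" "l > 0"
  shows "negate (dilate k A + fps_X * dilate l B) = dilate k A - fps_X * dilate l B"
  using assms negate_X_power[of 1] by (simp add: negate_add negate_mult negate_dilate)

lemma negate_theta_2_1_1_dissection:
  "negate (theta 2 1 1) = dilate 4 (theta 2 1 1) - fps_X * dilate 8 (theta 1 1 1)"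
  using arg_cong[OF theta_2_1_1_dissection, of negate] by (simp add: negate_parts)

text \<open>The product and the dissection show that the difference \<open>Y\<close> of the two sides satisfies
  \<open>Y(q) = - 2 Y(q^2)\<close>, hence vanishes.\<close>

lemma theta_2_1_1_squares:
  "theta 2 1 1 ^ 2 + negate (theta 2 1 1) ^ 2 = 2 * dilate 2 (theta 2 1 1) ^ 2" (is "?A = ?B")
proof -
  define p where "p = theta 2 1 1"
  define Y where "Y = p ^ 2 + negate p ^ 2 - 2 * dilate 2 p ^ 2"
  have f: "p * dilate 2 euler = negate euler ^ 2"
    unfolding p_def by (rule theta_2_1_1_product)
  have f': "negate p * dilate 2 euler = euler ^ 2"
    unfolding p_def by (rule negate_theta_2_1_1_product)
  have d: "dilate 2 (negate p) * dilate 4 euler = dilate 2 euler ^ 2"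
    using arg_cong[OF f', of "dilate 2"] by (simp add: dilate_mult dilate_power dilate_dilate)
  \<comment> \<open>Towards \<open>phi(q) phi(-q) = phi(-q^2)^2\<close>, multiplied through by the
    denominators of the product formulas.\<close>
  have "(p * negate p) * (dilate 2 euler ^ 2 * dilate 4 euler ^ 2)
      = (p * dilate 2 euler) * (negate p * dilate 2 euler) * dilate 4 euler ^ 2"
    by (simp only: power2_eq_square mult_ac)
  also have "\<dots> = (euler * negate euler * dilate 4 euler) ^ 2"
    unfolding f f' by (simp only: power2_eq_square mult_ac)
  also have "\<dots> = (dilate 2 euler ^ 2) ^ 2 * dilate 2 euler ^ 2"
    unfolding euler_mult_negate by (simp flip: power_mult power_add)
  also have "\<dots> = dilate 2 (negate p) ^ 2 * (dilate 2 euler ^ 2 * dilate 4 euler ^ 2)"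
    unfolding d[symmetric] by (simp only: power2_eq_square mult_ac)
  finally have prod: "p * negate p = dilate 2 (negate p) ^ 2"
    by (simp add: dilate_euler_nonzero)
  have neg: "negate p = dilate 4 p - fps_X * dilate 8 (theta 1 1 1)"
    unfolding p_def by (rule negate_theta_2_1_1_dissection)
  have pos: "p = dilate 4 p + fps_X * dilate 8 (theta 1 1 1)"
    unfolding p_def by (rule theta_2_1_1_dissection)
  have sum: "p + negate p = 2 * dilate 4 p"
    using pos neg by (metis add.commute add_diff_cancel_left' diff_add_cancel diff_add_eq mult_2)
  have "p ^ 2 + negate p ^ 2 = (p + negate p) ^ 2 - 2 * (p * negate p)"
    by (simp add: power2_eq_square algebra_simps)
  then have 1: "p ^ 2 + negate p ^ 2 = 4 * dilate 4 p ^ 2 - 2 * dilate 2 (negate p) ^ 2"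
    unfolding sum prod by (simp add: power_mult_distrib)
  have 2: "dilate 2 Y = dilate 2 p ^ 2 + dilate 2 (negate p) ^ 2 - 2 * dilate 4 p ^ 2"
    unfolding Y_def by (simp add: dilate_add dilate_diff dilate_mult dilate_power dilate_dilate dilate_numeral)
  have Y: "Y = - 2 * dilate 2 Y"
    unfolding 2 unfolding Y_def 1 by (simp add: algebra_simps)
  have "fps_nth Y n = 0" for n
  proof (induction n rule: less_induct)
    case (less n)
    have "fps_nth Y n = - 2 * fps_nth (dilate 2 Y) n"
      by (subst Y) (simp add: numeral_fps_const)
    then show ?case
      using less by (cases "n = 0") (auto simp: fps_nth_dilate)
  qed
  then have "Y = 0" by (simp add: fps_eq_iff)
  then show ?thesis unfolding Y_def p_def by simp
qed

text \<open>Jacobi's \<open>aequatio identica satis abstrusa\<close>.\<close>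

theorem Jacobi_abstruse:
  "negate euler ^ 8 - euler ^ 8 = 16 * fps_X * dilate 4 euler ^ 8"
proof -
  define p where "p = theta 2 1 1"
  define s where "s = theta 1 1 1"
  have f: "p * dilate 2 euler = negate euler ^ 2"
    unfolding p_def by (rule theta_2_1_1_product)
  have s: "s * euler = 2 * dilate 2 euler ^ 2"
    unfolding s_def by (rule theta_1_1_1_product)
  have s2: "dilate 2 s * dilate 2 euler = 2 * dilate 4 euler ^ 2"
    using arg_cong[OF s, of "dilate 2"]
    by (simp add: dilate_mult dilate_power dilate_dilate dilate_numeral)
  \<comment> \<open>This is \<open>psi(q)^2 = phi(q) psi(q^2)\<close>; the 2 appears because
    \<open>s\<close> is twice psi.\<close>
  have ss: "s ^ 2 = 2 * p * dilate 2 s"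
  proof -
    have "s ^ 2 * (euler ^ 2 * dilate 2 euler ^ 2) = 4 * (dilate 2 euler ^ 3) ^ 2"
    proof -
      have "s ^ 2 * (euler ^ 2 * dilate 2 euler ^ 2) = (s * euler) ^ 2 * dilate 2 euler ^ 2"
        by (simp only: power_mult_distrib mult_ac)
      then show ?thesis unfolding s by algebra
    qed
    also have "\<dots> = 2 * (p * dilate 2 euler) * (dilate 2 s * dilate 2 euler) * euler ^ 2"
      unfolding euler_mult_negate[symmetric] f s2 by algebra
    also have "\<dots> = 2 * p * dilate 2 s * (euler ^ 2 * dilate 2 euler ^ 2)"
      by algebra
    finally show ?thesis
      by (simp add: dilate_euler_nonzero euler_nonzero)
  qed
  have ss2: "dilate 2 s ^ 2 = 2 * dilate 2 p * dilate 4 s"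
    using arg_cong[OF ss, of "dilate 2"]
    by (simp add: dilate_mult dilate_power dilate_dilate dilate_numeral)
  have ss4: "dilate 4 s ^ 2 = 2 * dilate 4 p * dilate 8 s"
    using arg_cong[OF ss, of "dilate 4"]
    by (simp add: dilate_mult dilate_power dilate_dilate dilate_numeral)
  have pos: "p = dilate 4 p + fps_X * dilate 8 s"
    unfolding p_def s_def by (rule theta_2_1_1_dissection)
  have neg: "negate p = dilate 4 p - fps_X * dilate 8 s"
    unfolding p_def s_def by (rule negate_theta_2_1_1_dissection)
  have diff: "p ^ 2 - negate p ^ 2 = 2 * fps_X * dilate 4 s ^ 2"
    using pos neg ss4 by algebra
  have sum: "p ^ 2 + negate p ^ 2 = 2 * dilate 2 p ^ 2"
    unfolding p_def by (rule theta_2_1_1_squares)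
  \<comment> \<open>The theta constant identity \<open>theta_3^4 - theta_4^4 = theta_2^4\<close>.
    Multiplied by \<open>dilate 2 euler ^ 4\<close>, each theta series becomes a square of an Euler
    product, hence the eighth powers.\<close>
  have "p ^ 4 - negate p ^ 4 = fps_X * dilate 2 s ^ 4"
    using diff sum ss2 by algebra
  then have "(p * dilate 2 euler) ^ 4 - (negate p * dilate 2 euler) ^ 4
      = fps_X * (dilate 2 s * dilate 2 euler) ^ 4"
    by algebra
  moreover have "negate p * dilate 2 euler = euler ^ 2"
    unfolding p_def by (rule negate_theta_2_1_1_product)
  ultimately show ?thesis
    unfolding f s2 by (simp add: power_mult_distrib flip: power_mult)
qed

subsection \<open>The generating function\<close>

definition p8_fps :: "int fps" where
  "p8_fps = Abs_fps (\<lambda>n. int (p8 n))"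

text \<open>The generating function is given over the rationals, whereas congruences need integral
  series; this embedding transfers identities between them.\<close>

definition rat_fps :: "int fps \<Rightarrow> rat fps" where
  "rat_fps F = Abs_fps (\<lambda>n. of_int (fps_nth F n))"

lemma rat_fps_mult: "rat_fps (F * G) = rat_fps F * rat_fps G"
  and rat_fps_1: "rat_fps 1 = 1"
  and rat_fps_diff: "rat_fps (F - G) = rat_fps F - rat_fps G"
  and rat_fps_X_power: "rat_fps (fps_X ^ k) = fps_X ^ k"
  by (auto simp: rat_fps_def fps_eq_iff fps_mult_nth fps_X_power_nth)

lemma rat_fps_power: "rat_fps (F ^ k) = rat_fps F ^ k"
  by (induction k) (simp_all add: rat_fps_mult rat_fps_1)

lemma rat_fps_prod: "rat_fps (prod F A) = (\<Prod>i\<in>A. rat_fps (F i))"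
  by (induction A rule: infinite_finite_induct) (simp_all add: rat_fps_mult rat_fps_1)

lemma tendsto_rat_fps:
  assumes "(F \<longlongrightarrow> F') A"
  shows "((\<lambda>x. rat_fps (F x)) \<longlongrightarrow> rat_fps F') A"
proof (rule tendsto_fpsI)
  fix n
  have "eventually (\<lambda>x. fps_nth (F x) n = fps_nth F' n) A"
    using assms by (simp add: tendsto_fps_iff)
  then show "eventually (\<lambda>x. fps_nth (rat_fps (F x)) n = fps_nth (rat_fps F') n) A"
    by eventually_elim (simp add: rat_fps_def)
qed

text \<open>Makes \<open>p8_fps\<close> an inverse of \<open>euler ^ 8\<close> inside
  \<open>int fps\<close>, so that eta quotients can be written without division.\<close>

lemma euler_power_mult_p8_fps: "euler ^ 8 * p8_fps = 1"
proof -
  define g :: "nat \<Rightarrow> rat fps" where "g n = (\<Prod>j\<le>n. inverse ((1 - fps_X ^ Suc j) ^ 8))" for n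
  have g: "g \<longlonglongrightarrow> p8_gf"
  proof (rule tendsto_fpsI)
    show "eventually (\<lambda>N. fps_nth (g N) n = fps_nth p8_gf n) sequentially" for n
      using eventually_ge_at_top[of n]
      unfolding g_def p8_gf_nth by eventually_elim (rule p8_prod_stable)
  qed
  have "rat_fps (qfactorial 1 (Suc n) ^ 8) * g n = 1" for n
  proof -
    have "(1 - fps_X ^ Suc j) ^ 8 * inverse ((1 - fps_X ^ Suc j :: rat fps) ^ 8) = 1" for j
      by (rule inverse_mult_eq_1') (simp add: fps_power_zeroth)
    moreover have "rat_fps (1 - fps_X ^ Suc j) = 1 - fps_X ^ Suc j" for j
      by (simp only: rat_fps_diff rat_fps_1 rat_fps_X_power)
    then have "rat_fps (qfactorial 1 (Suc n) ^ 8) = (\<Prod>j\<le>n. (1 - fps_X ^ Suc j) ^ 8)"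
      unfolding rat_fps_power qfactorial_def
      by (simp only: rat_fps_prod mult_1 prod_power_distrib lessThan_Suc_atMost)
    ultimately show ?thesis
      unfolding g_def by (simp only: prod.distrib[symmetric] prod.neutral_const)
  qed
  moreover have "(\<lambda>n. rat_fps (qfactorial 1 (Suc n) ^ 8) * g n) \<longlonglongrightarrow> rat_fps (euler ^ 8) * p8_gf"
    by (intro tendsto_mult_fps tendsto_rat_fps tendsto_power_fps g
        LIMSEQ_Suc[OF qfactorial_tendsto_euler])
  ultimately have "rat_fps (euler ^ 8) * p8_gf = 1"
    using LIMSEQ_unique[OF tendsto_const] by fastforce
  moreover have "p8_gf = rat_fps p8_fps"
    unfolding p8_generating_function[symmetric] by (simp add: rat_fps_def p8_fps_def)
  ultimately have "rat_fps (euler ^ 8 * p8_fps) = rat_fps 1"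
    by (simp add: rat_fps_mult rat_fps_1)
  then show ?thesis
    by (simp add: rat_fps_def fps_eq_iff)
qed

subsection \<open>Even and odd parts\<close>

definition even_part :: "int fps \<Rightarrow> int fps" where
  "even_part F = Abs_fps (\<lambda>n. fps_nth F (2 * n))"

definition odd_part :: "int fps \<Rightarrow> int fps" where
  "odd_part F = Abs_fps (\<lambda>n. fps_nth F (2 * n + 1))"

lemma fps_nth_even_part [simp]: "fps_nth (even_part F) n = fps_nth F (2 * n)"
  by (simp add: even_part_def)

lemma fps_nth_odd_part [simp]: "fps_nth (odd_part F) n = fps_nth F (2 * n + 1)"
  by (simp add: odd_part_def)

lemma dilate_2_parts: "F = dilate 2 (even_part F) + fps_X * dilate 2 (odd_part F)"
  by (rule fps_ext) (auto simp: fps_nth_dilate)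

lemma parts_unique:
  assumes "F = dilate 2 A + fps_X * dilate 2 B"
  shows "even_part F = A" "odd_part F = B"
proof -
  have "\<not> 2 dvd 2 * n - Suc 0 \<or> n = 0" for n :: nat by presburger
  then show "even_part F = A" "odd_part F = B"
    unfolding assms by (auto simp: fps_eq_iff fps_nth_dilate)
qed

lemma dilate_2_inj: "dilate 2 A = dilate 2 B \<Longrightarrow> A = B"
  using parts_unique(1)[of "dilate 2 A" A 0] parts_unique(1)[of "dilate 2 B" B 0]
  by (simp add: dilate_def)

lemma even_part_mult:
    "even_part (F * G) = even_part F * even_part G + fps_X * (odd_part F * odd_part G)"
  and odd_part_mult: "odd_part (F * G) = even_part F * odd_part G + odd_part F * even_part G"
proof -
  have X: "dilate 2 fps_X = fps_X ^ 2"
    using dilate_X_power[of 2 1] by simp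
  have "F * G = (dilate 2 (even_part F) + fps_X * dilate 2 (odd_part F))
      * (dilate 2 (even_part G) + fps_X * dilate 2 (odd_part G))"
    using dilate_2_parts by simp
  also have "\<dots> = dilate 2 (even_part F * even_part G + fps_X * (odd_part F * odd_part G))
      + fps_X * dilate 2 (even_part F * odd_part G + odd_part F * even_part G)"
    by (simp add: dilate_add dilate_mult X algebra_simps power2_eq_square)
  finally have "F * G = \<dots>" .
  then show "even_part (F * G) = even_part F * even_part G + fps_X * (odd_part F * odd_part G)"
    and "odd_part (F * G) = even_part F * odd_part G + odd_part F * even_part G"
    by (fact parts_unique)+
qed

lemma even_part_add: "even_part (F + G) = even_part F + even_part G"
  and odd_part_add: "odd_part (F + G) = odd_part F + odd_part G"
  and even_part_const_mult: "even_part (fps_const c * F) = fps_const c * even_part F"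
  and odd_part_const_mult: "odd_part (fps_const c * F) = fps_const c * odd_part F"
  and even_part_numeral_mult: "even_part (numeral l * F) = numeral l * even_part F"
  and odd_part_numeral_mult: "odd_part (numeral l * F) = numeral l * odd_part F"
  by (auto simp: fps_eq_iff numeral_fps_const)

lemma parts_dilate_2: "even_part (dilate 2 A) = A" "odd_part (dilate 2 A) = 0"
  using parts_unique[of "dilate 2 A" A 0] by (simp_all add: dilate_def)

text \<open>Because of this rule, dissecting an eta quotient of level two reduces to dissecting a
  power of \<open>p8_fps\<close>.\<close>

lemma even_part_dilate_mult: "even_part (dilate 2 A * F) = A * even_part F"
  and odd_part_dilate_mult: "odd_part (dilate 2 A * F) = A * odd_part F"
  by (simp_all add: even_part_mult odd_part_mult parts_dilate_2)

lemma even_part_X_mult: "even_part (fps_X * F) = fps_X * odd_part F"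
  and odd_part_X_mult: "odd_part (fps_X * F) = even_part F"
proof -
  have "even_part fps_X = 0" "odd_part fps_X = 1"
    by (auto simp: fps_eq_iff fps_X_nth)
  then show "even_part (fps_X * F) = fps_X * odd_part F" "odd_part (fps_X * F) = even_part F"
    by (simp_all add: even_part_mult odd_part_mult)
qed

subsection \<open>Eta quotients of level two\<close>

text \<open>In the notation \<open>fk\<close> these are \<open>f2^16 / f1^24\<close>, \<open>f2^24 / f1^32\<close> and
  \<open>t = q f2^24 / f1^24\<close>, with \<open>p8_fps\<close> in the role of \<open>1 / f1^8\<close>.\<close>

definition eta_odd :: "int fps" where
  "eta_odd = dilate 2 euler ^ 16 * p8_fps ^ 3"

definition eta_even :: "int fps" where
  "eta_even = dilate 2 euler ^ 24 * p8_fps ^ 4"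

definition hauptmodul :: "int fps" where
  "hauptmodul = fps_X * dilate 2 euler ^ 24 * p8_fps ^ 3"

text \<open>With \<open>P = p8_fps\<close>,
  \<open>P(q) - P(-q) = P(q) P(-q) (f1(-q)^8 - f1(q)^8)\<close>, and Jacobi's identity evaluates the
  last factor. The product \<open>P(q) P(-q)\<close> is \<open>m(q^2)\<close> for
  \<open>m = f2^8 / f1^24\<close>; it is also \<open>u^2 - q v^2\<close> taken at
  \<open>q^2\<close>, which determines \<open>u^2\<close>.\<close>

lemma parts_p8_fps:
  shows odd_part_p8_fps: "odd_part p8_fps = 8 * eta_odd"
    and even_part_p8_fps_square:
      "even_part p8_fps ^ 2 = dilate 2 euler ^ 8 * p8_fps ^ 3 * (1 + 64 * hauptmodul)"
proof -
  define e where "e = euler ^ 8"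
  define P where "P = p8_fps"
  define u where "u = even_part P"
  define v where "v = odd_part P"
  define m where "m = dilate 2 e * P ^ 3"
  have eP: "e * P = 1" unfolding e_def P_def by (rule euler_power_mult_p8_fps)
  have neP: "negate e * negate P = 1"
    using arg_cong[OF eP, of negate] by (simp add: negate_mult negate_1)
  have e2P: "dilate 2 e * dilate 2 P = 1"
    using arg_cong[OF eP, of "dilate 2"] by (simp add: dilate_mult dilate_1)
  have ee: "e * negate e * dilate 4 e = dilate 2 e ^ 3"
    unfolding e_def negate_power dilate_power[of 4, simplified] dilate_power[of 2, simplified]
      power_mult_distrib[symmetric] euler_mult_negate by (simp flip: power_mult)
  have "dilate 2 m = dilate 4 e * dilate 2 P ^ 3"
    by (simp add: m_def dilate_mult dilate_power dilate_dilate)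
  then have PnP: "P * negate P = dilate 2 m"
    using ee eP neP e2P by algebra
  have jac: "negate e - e = 16 * fps_X * dilate 4 e"
    unfolding e_def negate_power dilate_power[of 4, simplified] by (rule Jacobi_abstruse)
  define h where "h = dilate 2 e * m"
  have h: "h = eta_odd"
    by (simp add: h_def m_def eta_odd_def P_def e_def dilate_power mult.assoc[symmetric]
        flip: power_add)
  have "P - negate P = (P * negate P) * (negate e - e)"
    using eP neP by algebra
  also have "\<dots> = 16 * fps_X * dilate 2 h"
    unfolding jac PnP h_def by (simp add: dilate_mult dilate_dilate mult_ac)
  finally have diff: "P - negate P = 16 * fps_X * dilate 2 h" .
  have P: "P = dilate 2 u + fps_X * dilate 2 v"
    unfolding u_def v_def by (rule dilate_2_parts)
  have nP: "negate P = dilate 2 u - fps_X * dilate 2 v"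
    using arg_cong[OF P, of negate] by (simp add: negate_parts)
  have "2 * fps_X * dilate 2 v = 2 * fps_X * dilate 2 (8 * h)"
    using diff P nP by (simp add: dilate_mult dilate_numeral)
  then have "dilate 2 v = dilate 2 (8 * h)" by simp
  then have v: "v = 8 * h" by (rule dilate_2_inj)
  then show "odd_part p8_fps = 8 * eta_odd"
    unfolding v_def P_def h .
  have X: "dilate 2 fps_X = fps_X ^ 2"
    using dilate_X_power[of 2 1] by simp
  have "dilate 2 m = dilate 2 (u ^ 2 - fps_X * v ^ 2)"
    unfolding PnP[symmetric] nP
    by (subst P) (simp add: dilate_mult dilate_diff dilate_power X algebra_simps power2_eq_square)
  then have "m = u ^ 2 - fps_X * v ^ 2" by (rule dilate_2_inj)
  moreover have "fps_X * v ^ 2 = 64 * hauptmodul * m"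
  proof -
    have "hauptmodul = fps_X * dilate 2 e ^ 3 * P ^ 3"
      by (simp add: hauptmodul_def P_def e_def dilate_power flip: power_mult)
    then show ?thesis
      unfolding v h_def m_def by algebra
  qed
  ultimately have "u ^ 2 = m * (1 + 64 * hauptmodul)"
    by (simp add: algebra_simps)
  then show "even_part p8_fps ^ 2 = dilate 2 euler ^ 8 * p8_fps ^ 3 * (1 + 64 * hauptmodul)"
    by (simp add: u_def m_def P_def e_def dilate_power)
qed

text \<open>Rescaling by \<open>128\<close> makes all coefficients of the dissections below integral and divisible by
  the powers of two that the iteration needs.\<close>

definition hauptmodul_128 :: "int fps" where
  "hauptmodul_128 = 128 * hauptmodul"

text \<open>Each series is a power of \<open>f2\<close> times a power of \<open>P\<close>, possibly
  times \<open>q\<close>. So only the parts of powers of \<open>P\<close> are needed; they are built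
  from \<open>u\<close> and \<open>v\<close>, with \<open>u^2\<close> and \<open>q v^2\<close>
  eliminated in favour of \<open>m\<close> and \<open>t\<close>.\<close>

lemma dissections:
  fixes s h k
  defines "s \<equiv> hauptmodul_128" and "h \<equiv> eta_odd" and "k \<equiv> eta_even"
  shows odd_part_eta_odd: "odd_part h = 8 * (k * (3 + 2 * s))"
    and odd_part_eta_odd_mult:
      "odd_part (h * s) = 128 * (k * (1 + 9 * s + 12 * s ^ 2 + 4 * s ^ 3))"
    and even_part_eta_even: "even_part k = h * (1 + 4 * s + 2 * s ^ 2)"
    and even_part_eta_even_mult:
      "even_part (k * s) = 8 * (h * s * (7 + 28 * s + 28 * s ^ 2 + 8 * s ^ 3))"
    and hauptmodul_quadratic: "s ^ 2 = dilate 2 (48 * s + 32 * s ^ 2) * s + 128 * dilate 2 s"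
proof -
  define e where "e = euler ^ 8"
  define b where "b = dilate 2 e"
  define P where "P = p8_fps"
  define u where "u = even_part P"
  define v where "v = odd_part P"
  define m where "m = b * P ^ 3"
  define t where "t = hauptmodul"
  define X :: "int fps" where "X = fps_X"
  have eP: "e * P = 1" unfolding e_def P_def by (rule euler_power_mult_p8_fps)
  have t: "t = X * b ^ 3 * P ^ 3"
    by (simp add: t_def hauptmodul_def P_def b_def e_def X_def dilate_power flip: power_mult)
  have h: "h = b ^ 2 * P ^ 3"
    by (simp add: h_def eta_odd_def P_def b_def e_def dilate_power flip: power_mult)
  have k: "k = b ^ 3 * P ^ 4"
    by (simp add: k_def eta_even_def P_def b_def e_def dilate_power flip: power_mult)
  have s: "s = 128 * t"
    by (simp add: s_def hauptmodul_128_def t_def)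
  have v: "v = 8 * h"
    unfolding v_def P_def h_def by (rule odd_part_p8_fps)
  have uu: "u ^ 2 = m * (1 + 64 * t)"
    unfolding u_def P_def m_def t_def b_def e_def
    using even_part_p8_fps_square by (simp add: dilate_power)
  have vv: "X * v ^ 2 = 64 * t * m"
    unfolding v h t m_def by algebra
  have E2: "even_part (P * P) = m * (1 + 128 * t)"
    using uu vv unfolding even_part_mult u_def[symmetric] v_def[symmetric] X_def[symmetric]
    by algebra
  have O2: "odd_part (P * P) = 2 * u * v"
    unfolding odd_part_mult u_def[symmetric] v_def[symmetric] by algebra
  have E3: "even_part (P * P * P) = u * m * (1 + 256 * t)"
    using uu vv unfolding even_part_mult[of "P * P"] E2 O2 u_def[symmetric] v_def[symmetric] X_def[symmetric]
    by algebra
  have O3: "odd_part (P * P * P) = v * m * (3 + 256 * t)"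
    using uu vv unfolding odd_part_mult[of "P * P"] E2 O2 u_def[symmetric] v_def[symmetric] X_def[symmetric]
    by algebra
  have E4: "even_part (P * P * (P * P)) = m ^ 2 * (1 + 512 * t + 32768 * t ^ 2)"
    using uu vv unfolding even_part_mult[of "P * P"] E2 O2 X_def[symmetric]
    by algebra
  have O4: "odd_part (P * P * (P * P)) = 4 * u * v * m * (1 + 128 * t)"
    unfolding odd_part_mult[of "P * P"] E2 O2 by algebra
  have E6: "even_part (P * P * P * (P * P * P))
      = m ^ 3 * (1 + 1152 * t + 196608 * t ^ 2 + 8388608 * t ^ 3)"
    using uu vv unfolding even_part_mult[of "P * P * P"] E3 O3 X_def[symmetric]
    by algebra
  have O7: "odd_part (P * P * P * (P * P * (P * P)))
      = v * m ^ 3 * (7 + 3584 * t + 458752 * t ^ 2 + 16777216 * t ^ 3)"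
    using uu unfolding odd_part_mult[of "P * P * P"] E3 O3 E4 O4
    by algebra

  have "h = dilate 2 (e ^ 2) * (P * P * P)"
    unfolding h b_def by (simp add: dilate_power power3_eq_cube)
  then have "odd_part h = e ^ 2 * (v * m * (3 + 256 * t))"
    by (simp only: odd_part_dilate_mult O3)
  also have "\<dots> = 8 * (k * (3 + 2 * s))"
    using eP unfolding v h k m_def s by algebra
  finally show "odd_part h = 8 * (k * (3 + 2 * s))" .

  \<comment> \<open>The factor \<open>X\<close> contained in \<open>s\<close> interchanges the
    parts, so the even part of \<open>P^6\<close> is what enters.\<close>
  have "h * s = 128 * (dilate 2 (e ^ 5) * (X * (P * P * P * (P * P * P))))"
    unfolding h s t b_def dilate_power[of 2, simplified] by algebra
  then have "odd_part (h * s) = 128 * (e ^ 5 * even_part (P * P * P * (P * P * P)))"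
    unfolding X_def by (simp only: odd_part_numeral_mult odd_part_dilate_mult odd_part_X_mult)
  also have "\<dots> = 128 * (k * (1 + 9 * s + 12 * s ^ 2 + 4 * s ^ 3))"
    using eP unfolding E6 k m_def s by algebra
  finally show "odd_part (h * s) = 128 * (k * (1 + 9 * s + 12 * s ^ 2 + 4 * s ^ 3))" .

  have "k = dilate 2 (e ^ 3) * (P * P * (P * P))"
    unfolding k b_def dilate_power[of 2, simplified] by algebra
  then have "even_part k = e ^ 3 * even_part (P * P * (P * P))"
    by (simp only: even_part_dilate_mult)
  also have "\<dots> = h * (1 + 4 * s + 2 * s ^ 2)"
    using eP unfolding E4 h m_def s by algebra
  finally show "even_part k = h * (1 + 4 * s + 2 * s ^ 2)" .

  have "k * s = 128 * (dilate 2 (e ^ 6) * (X * (P * P * P * (P * P * (P * P)))))"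
    unfolding k s t b_def dilate_power[of 2, simplified] by algebra
  then have "even_part (k * s) = 128 * (e ^ 6 * (X * odd_part (P * P * P * (P * P * (P * P)))))"
    unfolding X_def by (simp only: even_part_numeral_mult even_part_dilate_mult even_part_X_mult)
  also have "\<dots> = 8 * (h * s * (7 + 28 * s + 28 * s ^ 2 + 8 * s ^ 3))"
  proof -
    have em: "e ^ 6 * (X * m ^ 3) = t"
      using eP unfolding m_def t by algebra
    have "128 * (e ^ 6 * (X * odd_part (P * P * P * (P * P * (P * P)))))
        = 1024 * h * (e ^ 6 * (X * m ^ 3)) * (7 + 3584 * t + 458752 * t ^ 2 + 16777216 * t ^ 3)"
      unfolding O7 v by (simp add: mult_ac)
    then show ?thesis
      unfolding em s by (simp add: algebra_simps power2_eq_square power3_eq_cube)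
  qed
  finally show "even_part (k * s) = 8 * (h * s * (7 + 28 * s + 28 * s ^ 2 + 8 * s ^ 3))" .

  have t': "t = X * (dilate 2 (e ^ 3) * (P * P * P))"
    unfolding t b_def dilate_power[of 2, simplified] by algebra
  define p where "p = even_part t"
  define r where "r = odd_part t"
  have "p = X * (e ^ 3 * (v * m * (3 + 256 * t)))"
    unfolding p_def by (subst t', unfold X_def) (simp only: even_part_X_mult odd_part_dilate_mult O3)
  also have "\<dots> = 8 * t * (3 + 256 * t)"
  proof -
    have em: "X * (e ^ 3 * (h * m)) = t"
      using eP unfolding h m_def t by algebra
    have "X * (e ^ 3 * (v * m * (3 + 256 * t))) = 8 * (X * (e ^ 3 * (h * m))) * (3 + 256 * t)"
      unfolding v by (simp add: mult_ac)
    then show ?thesis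
      unfolding em .
  qed
  finally have p: "p = 8 * t * (3 + 256 * t)" .
  have r: "r = e ^ 3 * (u * m * (1 + 256 * t))"
    unfolding r_def by (subst t', unfold X_def) (simp only: odd_part_X_mult even_part_dilate_mult E3)
  have "X * r ^ 2 = t * ((1 + 64 * t) * (1 + 256 * t) ^ 2)"
  proof -
    have em: "e ^ 6 * (X * m ^ 3) = t"
      using eP unfolding m_def t by algebra
    have "X * r ^ 2 = u ^ 2 * (X * e ^ 6 * m ^ 2 * (1 + 256 * t) ^ 2)"
      unfolding r by algebra
    also have "\<dots> = (e ^ 6 * (X * m ^ 3)) * ((1 + 64 * t) * (1 + 256 * t) ^ 2)"
      unfolding uu by algebra
    finally show ?thesis
      unfolding em .
  qed
  \<comment> \<open>Equivalent to \<open>t(q) t(-q) = - t(q^2)\<close>. Together with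
    \<open>t(q) + t(-q) = 2 p(q^2)\<close> it makes \<open>t(q)\<close> and \<open>t(-q)\<close> the
    roots of the quadratic equation \<open>quad\<close>.\<close>
  then have norm: "X * r ^ 2 - p ^ 2 = t"
    unfolding p by algebra
  have tpr: "t = dilate 2 p + X * dilate 2 r"
    unfolding p_def r_def X_def by (rule dilate_2_parts)
  have "dilate 2 X = X ^ 2"
    using dilate_X_power[of 2 1] by (simp add: X_def)
  then have "X ^ 2 * dilate 2 r ^ 2 - dilate 2 p ^ 2 = dilate 2 t"
    using arg_cong[OF norm, of "dilate 2"] by (simp add: dilate_diff dilate_mult dilate_power)
  moreover have "(dilate 2 p + X * dilate 2 r) ^ 2 = 2 * dilate 2 p * (dilate 2 p + X * dilate 2 r)
      + (X ^ 2 * dilate 2 r ^ 2 - dilate 2 p ^ 2)"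
    by (simp add: algebra_simps power2_eq_square)
  ultimately have quad: "t ^ 2 = 2 * dilate 2 p * t + dilate 2 t"
    unfolding tpr[symmetric] by simp
  have p2: "dilate 2 p = 24 * dilate 2 t + 2048 * dilate 2 t ^ 2"
    unfolding p by (simp add: dilate_mult dilate_add dilate_numeral algebra_simps power2_eq_square)
  have "s ^ 2 = 16384 * (2 * dilate 2 p * t + dilate 2 t)"
    unfolding s quad[symmetric] by (simp add: power_mult_distrib)
  also have "\<dots> = dilate 2 (48 * s + 32 * s ^ 2) * s + 128 * dilate 2 s"
    unfolding p2 s
    by (simp add: dilate_mult dilate_add dilate_numeral dilate_power algebra_simps power2_eq_square)
  finally show "s ^ 2 = dilate 2 (48 * s + 32 * s ^ 2) * s + 128 * dilate 2 s" .
qed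

subsection \<open>Iteration\<close>

text \<open>The ring \<open>\<int>[s]\<close> with \<open>s = hauptmodul_128\<close>, generated by
  Horner's scheme so that its induction rule peels off one factor \<open>s\<close> at a
  time.\<close>

inductive_set hauptmodul_polys :: "int fps set" where
  const: "fps_const c \<in> hauptmodul_polys"
| step: "F \<in> hauptmodul_polys \<Longrightarrow> fps_const c + hauptmodul_128 * F \<in> hauptmodul_polys"

lemma hauptmodul_polys_add:
  "F \<in> hauptmodul_polys \<Longrightarrow> G \<in> hauptmodul_polys \<Longrightarrow> F + G \<in> hauptmodul_polys"
proof (induction F arbitrary: G rule: hauptmodul_polys.induct)
  case (const c)
  from const.prems show ?case
  proof cases
    case (const d)
    then show ?thesis by (metis fps_const_add hauptmodul_polys.const)
  next
    case (step F d)
    then have "fps_const c + G = fps_const (c + d) + hauptmodul_128 * F"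
      by (simp flip: fps_const_add)
    then show ?thesis using step by (simp only: hauptmodul_polys.step)
  qed
next
  case (step F c)
  from step.prems show ?case
  proof cases
    case (const d)
    then have "fps_const c + hauptmodul_128 * F + G = fps_const (c + d) + hauptmodul_128 * F"
      by (simp flip: fps_const_add)
    then show ?thesis using step by (simp only: hauptmodul_polys.step)
  next
    case (step G' d)
    then have "fps_const c + hauptmodul_128 * F + G = fps_const (c + d) + hauptmodul_128 * (F + G')"
      by (simp add: algebra_simps flip: fps_const_add)
    then show ?thesis using step.IH[OF step(2)] step by (simp only: hauptmodul_polys.step)
  qed
qed

lemma hauptmodul_128_mult_polys: "F \<in> hauptmodul_polys \<Longrightarrow> hauptmodul_128 * F \<in> hauptmodul_polys"
  using hauptmodul_polys.step[of F 0] by simp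

lemma const_mult_polys: "F \<in> hauptmodul_polys \<Longrightarrow> fps_const c * F \<in> hauptmodul_polys"
proof (induction F rule: hauptmodul_polys.induct)
  case (const d)
  show ?case by (simp add: hauptmodul_polys.const)
next
  case (step F d)
  then have "fps_const (c * d) + hauptmodul_128 * (fps_const c * F) \<in> hauptmodul_polys"
    by (intro hauptmodul_polys.step)
  then show ?case by (simp add: algebra_simps flip: fps_const_mult)
qed

lemma hauptmodul_polys_mult:
  "F \<in> hauptmodul_polys \<Longrightarrow> G \<in> hauptmodul_polys \<Longrightarrow> F * G \<in> hauptmodul_polys"
proof (induction F rule: hauptmodul_polys.induct)
  case (const c)
  then show ?case by (simp add: const_mult_polys)
next
  case (step F c)
  then have "fps_const c * G + hauptmodul_128 * (F * G) \<in> hauptmodul_polys"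
    by (intro hauptmodul_polys_add const_mult_polys hauptmodul_128_mult_polys)
  then show ?case by (simp add: algebra_simps)
qed

lemma hauptmodul_polys_numeral: "numeral c \<in> hauptmodul_polys" "1 \<in> hauptmodul_polys"
  using hauptmodul_polys.const[of "numeral c"] hauptmodul_polys.const[of 1]
  by (simp_all add: numeral_fps_const)

lemma hauptmodul_128_polys: "hauptmodul_128 \<in> hauptmodul_polys"
  using hauptmodul_128_mult_polys[OF hauptmodul_polys_numeral(2)] by simp

lemma hauptmodul_polys_power: "F \<in> hauptmodul_polys \<Longrightarrow> F ^ n \<in> hauptmodul_polys"
  by (induction n) (auto intro: hauptmodul_polys_mult hauptmodul_polys_numeral)

lemmas hauptmodul_polys_intros = hauptmodul_polys_add hauptmodul_polys_mult hauptmodul_polys_power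
  hauptmodul_polys_numeral hauptmodul_128_polys const_mult_polys hauptmodul_polys.const

text \<open>The induction runs over the Horner form; the quadratic equation of the hauptmodul reduces
  \<open>s * (s * F)\<close> to the two cases of the induction hypothesis.\<close>

lemma odd_part_eta_odd_polys:
  assumes "F \<in> hauptmodul_polys"
  shows "(\<exists>G\<in>hauptmodul_polys. odd_part (eta_odd * F) = 8 * (eta_even * G))
    \<and> (\<exists>G\<in>hauptmodul_polys. odd_part (eta_odd * (hauptmodul_128 * F)) = 128 * (eta_even * G))"
proof -
  define s where "s = hauptmodul_128"
  define h where "h = eta_odd"
  define k where "k = eta_even"
  have s: "s \<in> hauptmodul_polys" unfolding s_def by (rule hauptmodul_128_polys)
  define A where "A = 3 + 2 * s"
  define B where "B = 1 + 9 * s + 12 * s ^ 2 + 4 * s ^ 3"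
  have AB: "A \<in> hauptmodul_polys" "B \<in> hauptmodul_polys"
    unfolding A_def B_def by (intro hauptmodul_polys_intros s)+
  have hA: "odd_part h = 8 * (k * A)" and hB: "odd_part (h * s) = 128 * (k * B)"
    unfolding h_def k_def s_def A_def B_def by (fact odd_part_eta_odd odd_part_eta_odd_mult)+
  have "(\<exists>G\<in>hauptmodul_polys. odd_part (h * F) = 8 * (k * G))
    \<and> (\<exists>G\<in>hauptmodul_polys. odd_part (h * (s * F)) = 128 * (k * G))"
    using assms
  proof (induction F rule: hauptmodul_polys.induct)
    case (const c)
    have "odd_part (h * fps_const c) = 8 * (k * (fps_const c * A))"
      using odd_part_const_mult[of c h] hA by (simp add: mult_ac)
    moreover have "odd_part (h * (s * fps_const c)) = 128 * (k * (fps_const c * B))"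
      using odd_part_const_mult[of c "h * s"] hB by (simp add: mult_ac)
    ultimately show ?case
      using AB const_mult_polys by blast
  next
    case (step F c)
    then obtain G1 G2 where G: "G1 \<in> hauptmodul_polys" "odd_part (h * F) = 8 * (k * G1)"
      "G2 \<in> hauptmodul_polys" "odd_part (h * (s * F)) = 128 * (k * G2)"
      by blast
    have "h * (fps_const c + s * F) = fps_const c * h + h * (s * F)"
      by (simp add: algebra_simps)
    then have "odd_part (h * (fps_const c + s * F)) = 8 * (k * (fps_const c * A + 16 * G2))"
      by (simp only: odd_part_add odd_part_const_mult hA G) (simp add: algebra_simps)
    moreover have "odd_part (h * (s * (fps_const c + s * F)))
        = 128 * (k * (fps_const c * B + ((48 * s + 32 * s ^ 2) * G2 + 8 * (s * G1))))"
    proof -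
      have "h * (s * (fps_const c + s * F)) = fps_const c * (h * s) + s ^ 2 * (h * F)"
        by (simp add: algebra_simps power2_eq_square)
      also have "s ^ 2 * (h * F) = dilate 2 (48 * s + 32 * s ^ 2) * (h * (s * F))
          + 128 * (dilate 2 s * (h * F))"
        using arg_cong[OF hauptmodul_quadratic, of "\<lambda>x. x * (h * F)", folded s_def]
        by (simp only: distrib_right distrib_left mult_ac)
      finally have "odd_part (h * (s * (fps_const c + s * F)))
          = fps_const c * (128 * (k * B)) + ((48 * s + 32 * s ^ 2) * (128 * (k * G2))
            + 128 * (s * (8 * (k * G1))))"
        by (simp only: odd_part_add odd_part_const_mult odd_part_numeral_mult odd_part_dilate_mult hB G)
      then show ?thesis by (simp add: algebra_simps)
    qed
    moreover have "fps_const c * A + 16 * G2 \<in> hauptmodul_polys"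
      "fps_const c * B + ((48 * s + 32 * s ^ 2) * G2 + 8 * (s * G1)) \<in> hauptmodul_polys"
      by (intro hauptmodul_polys_intros s AB G)+
    ultimately show ?case
      unfolding s_def by blast
  qed
  then show ?thesis
    unfolding s_def h_def k_def .
qed

text \<open>In contrast to the odd parts, the first half gains no power of 2: in a round of the
  iteration the factor 8 comes from the odd part alone.\<close>

lemma even_part_eta_even_polys:
  assumes "F \<in> hauptmodul_polys"
  shows "(\<exists>G\<in>hauptmodul_polys. even_part (eta_even * F) = eta_odd * G)
    \<and> (\<exists>G\<in>hauptmodul_polys. even_part (eta_even * (hauptmodul_128 * F)) = 8 * (eta_odd * G))"
proof -
  define s where "s = hauptmodul_128"
  define h where "h = eta_odd"
  define k where "k = eta_even"
  have s: "s \<in> hauptmodul_polys" unfolding s_def by (rule hauptmodul_128_polys)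
  define A where "A = 1 + 4 * s + 2 * s ^ 2"
  define B where "B = s * (7 + 28 * s + 28 * s ^ 2 + 8 * s ^ 3)"
  have AB: "A \<in> hauptmodul_polys" "B \<in> hauptmodul_polys"
    unfolding A_def B_def by (intro hauptmodul_polys_intros s)+
  have kA: "even_part k = h * A" and kB: "even_part (k * s) = 8 * (h * B)"
    unfolding h_def k_def s_def A_def B_def
    using even_part_eta_even even_part_eta_even_mult by (simp_all only: mult.assoc)
  have "(\<exists>G\<in>hauptmodul_polys. even_part (k * F) = h * G)
    \<and> (\<exists>G\<in>hauptmodul_polys. even_part (k * (s * F)) = 8 * (h * G))"
    using assms
  proof (induction F rule: hauptmodul_polys.induct)
    case (const c)
    have "even_part (k * fps_const c) = h * (fps_const c * A)"
      using even_part_const_mult[of c k] kA by (simp add: mult_ac)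
    moreover have "even_part (k * (s * fps_const c)) = 8 * (h * (fps_const c * B))"
      using even_part_const_mult[of c "k * s"] kB by (simp add: mult_ac)
    ultimately show ?case
      using AB const_mult_polys by blast
  next
    case (step F c)
    then obtain G1 G2 where G: "G1 \<in> hauptmodul_polys" "even_part (k * F) = h * G1"
      "G2 \<in> hauptmodul_polys" "even_part (k * (s * F)) = 8 * (h * G2)"
      by blast
    have "k * (fps_const c + s * F) = fps_const c * k + k * (s * F)"
      by (simp add: algebra_simps)
    then have "even_part (k * (fps_const c + s * F)) = h * (fps_const c * A + 8 * G2)"
      by (simp only: even_part_add even_part_const_mult kA G) (simp add: algebra_simps)
    moreover have "even_part (k * (s * (fps_const c + s * F)))
        = 8 * (h * (fps_const c * B + ((48 * s + 32 * s ^ 2) * G2 + 16 * (s * G1))))"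
    proof -
      have "k * (s * (fps_const c + s * F)) = fps_const c * (k * s) + s ^ 2 * (k * F)"
        by (simp add: algebra_simps power2_eq_square)
      also have "s ^ 2 * (k * F) = dilate 2 (48 * s + 32 * s ^ 2) * (k * (s * F))
          + 128 * (dilate 2 s * (k * F))"
        using arg_cong[OF hauptmodul_quadratic, of "\<lambda>x. x * (k * F)", folded s_def]
        by (simp only: distrib_right distrib_left mult_ac)
      finally have "even_part (k * (s * (fps_const c + s * F)))
          = fps_const c * (8 * (h * B)) + ((48 * s + 32 * s ^ 2) * (8 * (h * G2))
            + 128 * (s * (h * G1)))"
        by (simp only: even_part_add even_part_const_mult even_part_numeral_mult even_part_dilate_mult kB G)
      then show ?thesis by (simp add: algebra_simps)
    qed
    moreover have "fps_const c * A + 8 * G2 \<in> hauptmodul_polys"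
      "fps_const c * B + ((48 * s + 32 * s ^ 2) * G2 + 16 * (s * G1)) \<in> hauptmodul_polys"
      by (intro hauptmodul_polys_intros s AB G)+
    ultimately show ?case
      unfolding s_def by blast
  qed
  then show ?thesis
    unfolding s_def h_def k_def .
qed

text \<open>Beyond its constant term, a Horner form is a multiple of \<open>s\<close>, hence of
  128.\<close>

lemma hauptmodul_polys_cong:
  assumes "F \<in> hauptmodul_polys"
  obtains c G where "F = fps_const c + 128 * G"
  using assms
proof cases
  case (const c)
  then show ?thesis using that[of c 0] by simp
next
  case (step G c)
  then show ?thesis using that[of c "hauptmodul * G"] by (simp add: hauptmodul_128_def mult.assoc)
qed

text \<open>With \<open>A = 2 ^ (2 * \<beta> + 1)\<close> the positions are the \<open>N\<close>
  with \<open>3 N - 1 = A (3 n + 1)\<close>. For \<open>n = 4 l + 1\<close> the right side is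
  \<open>4 A (3 l + 1)\<close>, so the next slice is an odd part followed by an even part.\<close>

definition p8_slice :: "nat \<Rightarrow> int fps" where
  "p8_slice \<beta> = Abs_fps (\<lambda>n. int (p8 (2 ^ (2 * \<beta> + 1) * n + (2 ^ (2 * \<beta> + 1) + 1) div 3)))"

lemma two_power_odd_mod_3: "\<exists>w. 2 ^ (2 * \<beta> + 1) = 3 * w + (2::nat)"
proof (induction \<beta>)
  case 0
  show ?case by simp
next
  case (Suc \<beta>)
  then obtain w where "2 ^ (2 * \<beta> + 1) = 3 * w + (2::nat)" by blast
  then have "2 ^ (2 * Suc \<beta> + 1) = 3 * (4 * w + 2) + (2::nat)" by simp
  then show ?case by blast
qed

lemma p8_slice_Suc: "p8_slice (Suc \<beta>) = even_part (odd_part (p8_slice \<beta>))"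
proof (rule fps_ext)
  fix n
  obtain w where w: "2 ^ (2 * \<beta> + 1) = 3 * w + (2::nat)"
    using two_power_odd_mod_3 by blast
  then have w': "2 ^ (2 * Suc \<beta> + 1) = 12 * w + (8::nat)" by simp
  have "(3 * w + 2 + 1) div 3 = w + 1" "(12 * w + 8 + 1) div 3 = 4 * w + 3"
    by simp_all
  then show "fps_nth (p8_slice (Suc \<beta>)) n = fps_nth (even_part (odd_part (p8_slice \<beta>))) n"
    unfolding p8_slice_def fps_nth_even_part fps_nth_odd_part fps_nth_Abs_fps w w'
    by (simp add: algebra_simps)
qed

lemma p8_slice_0: "p8_slice 0 = 8 * eta_odd"
  unfolding odd_part_p8_fps[symmetric] by (simp add: fps_eq_iff p8_slice_def p8_fps_def)

lemma eight_power_fps: "(8 :: int fps) ^ n = fps_const (8 ^ n)"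
  by (simp add: numeral_fps_const)

lemma p8_slice_eq: "\<exists>G\<in>hauptmodul_polys. p8_slice \<beta> = 8 ^ (\<beta> + 1) * (eta_odd * G)"
proof (induction \<beta>)
  case 0
  show ?case
    using hauptmodul_polys_numeral(2) by (intro bexI[of _ 1]) (simp_all add: p8_slice_0)
next
  case (Suc \<beta>)
  then obtain G where G: "G \<in> hauptmodul_polys" "p8_slice \<beta> = 8 ^ (\<beta> + 1) * (eta_odd * G)"
    by blast
  obtain H where H: "H \<in> hauptmodul_polys" "odd_part (eta_odd * G) = 8 * (eta_even * H)"
    using odd_part_eta_odd_polys[OF G(1)] by blast
  obtain K where K: "K \<in> hauptmodul_polys" "even_part (eta_even * H) = eta_odd * K"
    using even_part_eta_even_polys[OF H(1)] by blast
  have "p8_slice (Suc \<beta>) = 8 ^ (\<beta> + 1) * (8 * (eta_odd * K))"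
    unfolding p8_slice_Suc G(2) eight_power_fps odd_part_const_mult H(2)
      even_part_const_mult even_part_numeral_mult K(2) ..
  then show ?case
    using K(1) by (intro bexI[of _ K]) (simp_all add: mult_ac)
qed

text \<open>The unknown integer \<open>c\<close> is harmless, since only divisibility of the
  coefficients of \<open>eta_odd\<close> by divisors of 128 is to be transferred.\<close>

lemma p8_slice_cong:
  obtains c R where "p8_slice \<beta> = 8 ^ (\<beta> + 1) * (fps_const c * eta_odd + 128 * R)"
proof -
  obtain G where G: "G \<in> hauptmodul_polys" "p8_slice \<beta> = 8 ^ (\<beta> + 1) * (eta_odd * G)"
    using p8_slice_eq by blast
  obtain c H where "G = fps_const c + 128 * H"
    using hauptmodul_polys_cong[OF G(1)] .
  then have "p8_slice \<beta> = 8 ^ (\<beta> + 1) * (fps_const c * eta_odd + 128 * (eta_odd * H))"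
    unfolding G(2) by (simp add: algebra_simps)
  then show ?thesis by (rule that)
qed

text \<open>Stopping halfway through a round leaves \<open>eta_even\<close> and one more factor 8;
  the claims with exponents \<open>3 \<alpha> + 8\<close>, \<open>3 \<alpha> + 9\<close>,
  \<open>3 \<alpha> + 10\<close> come from here.\<close>

lemma odd_part_p8_slice_cong:
  obtains c R where "odd_part (p8_slice \<beta>) = 8 ^ (\<beta> + 2) * (fps_const c * eta_even + 128 * R)"
proof -
  obtain G where G: "G \<in> hauptmodul_polys" "p8_slice \<beta> = 8 ^ (\<beta> + 1) * (eta_odd * G)"
    using p8_slice_eq by blast
  obtain H where H: "H \<in> hauptmodul_polys" "odd_part (eta_odd * G) = 8 * (eta_even * H)"
    using odd_part_eta_odd_polys[OF G(1)] by blast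
  obtain c K where "H = fps_const c + 128 * K"
    using hauptmodul_polys_cong[OF H(1)] .
  then have "odd_part (p8_slice \<beta>) = 8 ^ (\<beta> + 1) * (8 * (eta_even * (fps_const c + 128 * K)))"
    unfolding G(2) eight_power_fps odd_part_const_mult H(2) by simp
  then have "odd_part (p8_slice \<beta>) = 8 ^ (\<beta> + 2) * (fps_const c * eta_even + 128 * (eta_even * K))"
    by (simp add: algebra_simps)
  then show ?thesis by (rule that)
qed

subsection \<open>Congruences modulo powers of two\<close>

lemma fps_const_dvd_nth:
  fixes F :: "int fps"
  assumes "fps_const m dvd F"
  shows "m dvd fps_nth F n"
  using assms by (auto elim!: dvdE)

lemma dvd_diff_trans:
  fixes m :: "'a::comm_ring_1"
  assumes "m dvd A - B" "m dvd B - C"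
  shows "m dvd A - C"
  using dvd_add[OF assms] by simp

lemma dvd_diff_mult:
  fixes m :: "'a::comm_ring_1"
  assumes "m dvd A - B" "m dvd C - D"
  shows "m dvd A * C - B * D"
proof -
  have "A * C - B * D = (A - B) * C + B * (C - D)" by (simp add: algebra_simps)
  then show ?thesis using assms by simp
qed

lemma dvd_diff_power:
  fixes m :: "'a::comm_ring_1"
  assumes "m dvd A - B"
  shows "m dvd A ^ n - B ^ n"
  by (induction n) (simp_all add: dvd_diff_mult assms)

text \<open>If \<open>A = B + m x\<close> with \<open>m\<close> even, both \<open>2 m B x\<close>
  and \<open>m^2 x^2\<close> are multiples of \<open>2 m\<close>. Repeated squaring thus lifts the
  congruence between \<open>euler ^ 2\<close> and \<open>dilate 2 euler\<close> from modulus 2 to 4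
  and 8.\<close>

lemma double_dvd_diff_squares:
  fixes m :: "'a::comm_ring_1"
  assumes "m dvd A - B" "2 dvd m"
  shows "2 * m dvd A ^ 2 - B ^ 2"
proof -
  obtain x where x: "A - B = m * x" using assms(1) by (elim dvdE)
  then have A: "A = B + m * x" by (simp add: algebra_simps)
  obtain y where y: "m = 2 * y" using assms(2) by (elim dvdE)
  have "A ^ 2 - B ^ 2 = 2 * m * (B * x + y * x ^ 2)"
    unfolding A unfolding y by (simp add: algebra_simps power2_eq_square)
  then show ?thesis by simp
qed

lemma dilate_dvd:
  assumes "numeral m dvd F - G" "k > 0"
  shows "numeral m dvd dilate k F - dilate k G"
proof -
  obtain x where "F - G = numeral m * x" using assms(1) by (elim dvdE)
  then have "dilate k F - dilate k G = numeral m * dilate k x"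
    using assms(2) by (simp add: dilate_mult dilate_numeral flip: dilate_diff)
  then show ?thesis by simp
qed

lemma even_part_dvd:
  assumes "numeral m dvd F - G"
  shows "numeral m dvd even_part F - even_part G"
proof -
  obtain x where "F - G = numeral m * x" using assms by (elim dvdE)
  then have "F = G + numeral m * x" by (simp add: algebra_simps)
  then show ?thesis by (simp add: even_part_add even_part_numeral_mult)
qed

lemma two_dvd_fpsI:
  assumes "\<And>n. even (fps_nth F n)"
  shows "2 dvd (F :: int fps)"
proof -
  have "F = 2 * Abs_fps (\<lambda>n. fps_nth F n div 2)"
    using assms by (simp add: fps_eq_iff numeral_fps_const)
  then show ?thesis by (metis dvd_triv_left)
qed

text \<open>Frobenius modulo 2. The odd part of \<open>F^2\<close> is twice a product; with
  \<open>u\<close>, \<open>v\<close> the parts of \<open>F\<close>, the even part of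
  \<open>F^2 - F(q^2)\<close> is \<open>(u^2 - u(q^2)) + q (v^2 - v(q^2))\<close>. So the induction
  on the index needs all \<open>F\<close> at once.\<close>

lemma square_cong_dilate: "2 dvd F ^ 2 - dilate 2 F"
proof (rule two_dvd_fpsI)
  fix n
  show "even (fps_nth (F ^ 2 - dilate 2 F) n)"
  proof (induction n arbitrary: F rule: less_induct)
    case (less n)
    show ?case
    proof (cases "even n")
      case False
      then obtain m where m: "n = 2 * m + 1" by (elim oddE)
      have "fps_nth (F ^ 2) n = fps_nth (odd_part (F * F)) m"
        by (simp add: m power2_eq_square)
      also have "odd_part (F * F) = 2 * (even_part F * odd_part F)"
        by (simp add: odd_part_mult mult.commute)
      finally show ?thesis
        using False by (simp add: fps_nth_dilate numeral_fps_const)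
    next
      case True
      then obtain m where m: "n = 2 * m" by (elim evenE)
      show ?thesis
      proof (cases "m = 0")
        case True
        then show ?thesis by (simp add: m power2_eq_square)
      next
        case False
        define u where "u = even_part F"
        define v where "v = odd_part F"
        have "fps_nth (F ^ 2) n = fps_nth (even_part (F * F)) m"
          by (simp add: m power2_eq_square)
        also have "even_part (F * F) = u ^ 2 + fps_X * v ^ 2"
          by (simp add: even_part_mult u_def v_def power2_eq_square)
        finally have 1: "fps_nth (F ^ 2) n = fps_nth (u ^ 2) m + fps_nth (v ^ 2) (m - 1)"
          using False by simp
        have "fps_nth (dilate 2 F) n = fps_nth F m"
          by (simp add: m fps_nth_dilate)
        also have "\<dots> = fps_nth (dilate 2 u + fps_X * dilate 2 v) m"
          unfolding u_def v_def using dilate_2_parts by simp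
        finally have 2: "fps_nth (dilate 2 F) n = fps_nth (dilate 2 u) m + fps_nth (dilate 2 v) (m - 1)"
          using False by simp
        have "fps_nth (F ^ 2 - dilate 2 F) n
            = fps_nth (u ^ 2 - dilate 2 u) m + fps_nth (v ^ 2 - dilate 2 v) (m - 1)"
          by (simp add: 1 2)
        moreover have "m < n" "m - 1 < n" using False m by auto
        ultimately show ?thesis
          using less.IH by simp
      qed
    qed
  qed
qed

lemma euler_2_cong: "2 dvd euler ^ 2 - dilate 2 euler"
  by (rule square_cong_dilate)

lemma euler_4_cong: "4 dvd euler ^ 4 - dilate 2 euler ^ 2"
  using double_dvd_diff_squares[OF euler_2_cong] by (simp flip: power_mult)

lemma two_dvd_four: "2 dvd (4::'a::comm_ring_1)"
  and two_dvd_eight: "2 dvd (8::'a::comm_ring_1)"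
  and four_dvd_eight: "4 dvd (8::'a::comm_ring_1)"
  using dvd_triv_left[of "2::'a" 2] dvd_triv_left[of "2::'a" 4] dvd_triv_left[of "4::'a" 2]
  by simp_all

lemma euler_8_cong: "8 dvd euler ^ 8 - dilate 2 euler ^ 4"
  using double_dvd_diff_squares[OF euler_4_cong two_dvd_four] by (simp flip: power_mult)

lemma euler_4_cong_2: "2 dvd euler ^ 4 - dilate 4 euler"
proof -
  have "2 dvd euler ^ 4 - dilate 2 euler ^ 2"
    by (rule dvd_trans[OF two_dvd_four euler_4_cong])
  moreover have "2 dvd dilate 2 euler ^ 2 - dilate 2 (dilate 2 euler)"
    by (rule square_cong_dilate)
  ultimately show ?thesis
    using dvd_diff_trans by (simp add: dilate_dilate) blast
qed

lemma dilate_2_euler_mult_p8_fps: "dilate 2 euler ^ 8 * dilate 2 p8_fps = 1"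
  using arg_cong[OF euler_power_mult_p8_fps, of "dilate 2"]
  by (simp add: dilate_mult dilate_power dilate_1)

text \<open>From \<open>1/a - 1/b = (b - a) / (a b)\<close> with \<open>a = f1^8\<close> and
  \<open>b = f2^4\<close>, where \<open>1/b\<close> is written as
  \<open>dilate 2 p8_fps * dilate 2 euler ^ 4\<close>.\<close>

lemma p8_fps_cong: "8 dvd p8_fps - dilate 2 p8_fps * dilate 2 euler ^ 4"
proof -
  have "p8_fps - dilate 2 p8_fps * dilate 2 euler ^ 4
      = p8_fps * dilate 2 p8_fps * dilate 2 euler ^ 4 * (dilate 2 euler ^ 4 - euler ^ 8)"
    using dilate_2_euler_mult_p8_fps euler_power_mult_p8_fps by algebra
  moreover have "8 dvd dilate 2 euler ^ 4 - euler ^ 8"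
    using euler_8_cong dvd_minus_iff[of 8 "euler ^ 8 - dilate 2 euler ^ 4"] by simp
  ultimately show ?thesis
    by simp
qed

text \<open>Cubing the previous congruence turns \<open>f2^16 / f1^24\<close> into
  \<open>f2^16 / f2^12\<close>.\<close>

lemma eta_odd_cong: "8 dvd eta_odd - dilate 2 (euler ^ 4)"
proof -
  have "8 dvd dilate 2 euler ^ 16 * p8_fps ^ 3
      - dilate 2 euler ^ 16 * (dilate 2 p8_fps * dilate 2 euler ^ 4) ^ 3"
    by (intro dvd_diff_mult dvd_diff_power p8_fps_cong) simp
  also have "dilate 2 euler ^ 16 * (dilate 2 p8_fps * dilate 2 euler ^ 4) ^ 3 = dilate 2 euler ^ 4"
    using dilate_2_euler_mult_p8_fps by algebra
  finally show ?thesis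
    by (simp add: eta_odd_def dilate_power)
qed

text \<open>Modulo 8 the series \<open>p8_fps\<close> lies in \<open>q^2\<close>, so its even part
  can be read off.\<close>

lemma even_part_p8_fps_cong: "8 dvd even_part p8_fps - p8_fps * euler ^ 4"
proof -
  have "8 dvd p8_fps - dilate 2 (p8_fps * euler ^ 4)"
    using p8_fps_cong by (simp add: dilate_mult dilate_power)
  from even_part_dvd[OF this] show ?thesis
    by (simp add: parts_dilate_2)
qed

text \<open>Here \<open>euler ^ 15 * p8_fps\<close> is \<open>euler ^ 7\<close>; what matters for
  coefficients is that modulo 8 the odd part of \<open>f1^4\<close> lies in \<open>q^2\<close>. The
  parts \<open>A\<close>, \<open>B\<close> of \<open>f1^4\<close> satisfy
  \<open>2 A B = - 8 f2^8\<close> by Jacobi's identity, and \<open>A\<close> is \<open>f2\<close>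
  modulo 2, so \<open>B\<close> can be solved for.\<close>

lemma odd_part_euler_4_cong: "8 dvd odd_part (euler ^ 4) + 4 * dilate 2 (euler ^ 15 * p8_fps)"
proof -
  define A where "A = even_part (euler ^ 4)"
  define B where "B = odd_part (euler ^ 4)"
  define f where "f = dilate 2 euler"
  define Q where "Q = dilate 2 p8_fps"
  have fQ: "f ^ 8 * Q = 1"
    unfolding f_def Q_def by (rule dilate_2_euler_mult_p8_fps)
  have "odd_part (euler ^ 8) = odd_part (euler ^ 4 * euler ^ 4)"
    by (simp flip: power_add)
  also have "\<dots> = 2 * (A * B)"
    unfolding odd_part_mult A_def[symmetric] B_def[symmetric] by algebra
  finally have AB: "odd_part (euler ^ 8) = 2 * (A * B)" .
  have "fps_nth (odd_part (negate euler ^ 8)) n = - fps_nth (odd_part (euler ^ 8)) n" for n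
    by (simp add: fps_nth_negate flip: negate_power)
  then have "odd_part (negate euler ^ 8) = - odd_part (euler ^ 8)"
    by (simp add: fps_eq_iff)
  moreover have "negate euler ^ 8 = euler ^ 8 + 16 * (fps_X * dilate 2 (f ^ 8))"
    using Jacobi_abstruse by (simp add: f_def dilate_power dilate_dilate algebra_simps)
  ultimately have "- (2 * (A * B)) = 2 * (A * B) + 16 * f ^ 8"
    using AB by (simp only: odd_part_add odd_part_numeral_mult odd_part_X_mult parts_dilate_2)
  then have "4 * (A * B) = 4 * (- 4 * f ^ 8)"
    by algebra
  then have AB': "A * B = - 4 * f ^ 8"
    by (simp only: mult_cancel_left) simp
  have "2 dvd euler ^ 4 - dilate 2 f"
    using euler_4_cong_2 by (simp add: f_def dilate_dilate)
  from even_part_dvd[OF this] have "2 dvd A - f"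
    by (simp add: A_def parts_dilate_2)
  then obtain x where "A - f = 2 * x" by (elim dvdE)
  then have A: "A = f + 2 * x" by (simp add: algebra_simps)
  \<comment> \<open>Multiplying by \<open>1/f = f^7 * Q\<close> isolates \<open>B\<close>, with a
    remainder \<open>2 (...) B\<close>. Fed into itself, the equation shows that \<open>B\<close> is
    divisible by 2, then by 4, and finally gives its value modulo 8.\<close>
  have B: "B = - 4 * (f ^ 15 * Q) - 2 * (x * f ^ 7 * Q * B)"
    using AB' fQ unfolding A by algebra
  then have "B = 2 * (- 2 * (f ^ 15 * Q) - x * f ^ 7 * Q * B)"
    by (simp add: algebra_simps)
  then obtain B1 where B1: "B = 2 * B1" by blast
  have "B = 4 * (- (f ^ 15 * Q) - x * f ^ 7 * Q * B1)"
    using B unfolding B1 by algebra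
  then obtain B2 where B2: "B = 4 * B2" by blast
  have "B + 4 * (f ^ 15 * Q) = 8 * (- (x * f ^ 7 * Q * B2))"
    using B unfolding B2 by algebra
  then show ?thesis
    unfolding B_def f_def Q_def by (simp add: dilate_mult dilate_power)
qed

text \<open>The odd part of \<open>P^4\<close> is \<open>4 (u^2 + q v^2) u v\<close>, where
  \<open>v\<close> is 8 times a series. The cube of \<open>v\<close> therefore contributes a
  multiple of 2048, and \<open>32 u^3 f2^16\<close> remains, for which \<open>u\<close> modulo 4
  suffices.\<close>

lemma odd_part_eta_even_cong: "128 dvd odd_part eta_even - 32 * dilate 2 (euler ^ 10)"
proof -
  define e where "e = euler ^ 8"
  define b where "b = dilate 2 e"
  define P where "P = p8_fps"
  define u where "u = even_part P"
  define v where "v = odd_part P"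
  define f where "f = dilate 2 euler"
  have eP: "e * P = 1" unfolding e_def P_def by (rule euler_power_mult_p8_fps)
  have b: "b = f ^ 8" by (simp add: b_def e_def f_def dilate_power)
  have v: "v = 8 * (b ^ 2 * P ^ 3)"
    unfolding v_def P_def odd_part_p8_fps
    by (simp add: eta_odd_def b_def e_def dilate_power flip: power_mult)
  have k: "eta_even = dilate 2 (e ^ 3) * (P * P * (P * P))"
    by (simp add: eta_even_def e_def P_def dilate_power power4_eq_xxxx mult_ac flip: power_mult)
  have "odd_part eta_even = e ^ 3 * odd_part (P * P * (P * P))"
    unfolding k by (rule odd_part_dilate_mult)
  also have "odd_part (P * P * (P * P)) = 4 * ((u ^ 2 + fps_X * v ^ 2) * (u * v))"
    unfolding odd_part_mult even_part_mult u_def[symmetric] v_def[symmetric]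
    by (simp add: algebra_simps power2_eq_square)
  also have "e ^ 3 * (4 * ((u ^ 2 + fps_X * v ^ 2) * (u * v)))
      = 32 * ((u * f ^ 2) ^ 3 * f ^ 10) + 128 * (16 * fps_X * b ^ 4 * P ^ 6 * (u * b ^ 2))"
    using eP unfolding v unfolding b by algebra
  finally have 1: "odd_part eta_even = \<dots>" .
  \<comment> \<open>Modulo 4, \<open>u\<close> is \<open>1/f1^4\<close> and \<open>f2^2\<close> is
    \<open>f1^4\<close>, so their product is 1.\<close>
  have "4 dvd u * f ^ 2 - (P * euler ^ 4) * euler ^ 4"
  proof (rule dvd_diff_mult)
    show "4 dvd u - P * euler ^ 4"
      unfolding u_def P_def by (rule dvd_trans[OF four_dvd_eight even_part_p8_fps_cong])
    show "4 dvd f ^ 2 - euler ^ 4"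
      using euler_4_cong dvd_minus_iff[of 4 "euler ^ 4 - f ^ 2"] by (simp add: f_def)
  qed
  also have "P * euler ^ 4 * euler ^ 4 = 1"
    using eP by (simp add: e_def mult_ac flip: power_add)
  finally have "4 dvd (u * f ^ 2) ^ 3 * f ^ 10 - 1 ^ 3 * f ^ 10"
    by (intro dvd_diff_mult dvd_diff_power) simp_all
  then obtain x where "(u * f ^ 2) ^ 3 * f ^ 10 - 1 ^ 3 * f ^ 10 = 4 * x"
    by (elim dvdE)
  then have x: "(u * f ^ 2) ^ 3 * f ^ 10 = f ^ 10 + 4 * x"
    by (simp add: algebra_simps)
  have "odd_part eta_even - 32 * dilate 2 (euler ^ 10)
      = 128 * (x + 16 * fps_X * b ^ 4 * P ^ 6 * (u * b ^ 2))"
    unfolding 1 x by (simp add: f_def dilate_power algebra_simps)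
  then show ?thesis by (simp only: dvd_triv_left)
qed

lemma euler_10_cong: "2 dvd dilate 2 (euler ^ 10) - dilate 4 (euler ^ 5)"
proof -
  have "2 dvd dilate 2 (euler ^ 2) - dilate 2 (dilate 2 euler)"
    by (rule dilate_dvd[OF euler_2_cong]) simp
  from dvd_diff_power[OF this, of 5] show ?thesis
    by (simp add: dilate_power dilate_dilate flip: power_mult)
qed

lemma fps_nth_dvd:
  assumes "numeral m dvd (F :: int fps)"
  shows "numeral m dvd fps_nth F n"
  using assms by (intro fps_const_dvd_nth) (simp add: numeral_fps_const)

section \<open>Coefficients of the two eta quotients in arithmetic progressions\<close>

text \<open>\<open>eta_odd\<close> is \<open>f2^4\<close> modulo 8, \<open>f4^2\<close> modulo 4 and
  \<open>f8\<close> modulo 2: series in \<open>q^2\<close>, \<open>q^4\<close>, \<open>q^8\<close>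
  vanish off the multiples of 2, 4, 8. At \<open>8 n + 6\<close> the modulus 8 is kept by
  \<open>odd_part_euler_4_cong\<close>; at \<open>8 n\<close> the pentagonal number theorem
  decides.\<close>

lemma fps_nth_eta_odd:
  shows fps_nth_eta_odd_1: "8 dvd fps_nth eta_odd (2 * n + 1)"
    and fps_nth_eta_odd_2: "4 dvd fps_nth eta_odd (4 * n + 2)"
    and fps_nth_eta_odd_4: "2 dvd fps_nth eta_odd (8 * n + 4)"
    and fps_nth_eta_odd_6: "8 dvd fps_nth eta_odd (8 * n + 6)"
    and fps_nth_eta_odd_0: "\<not> generalised_pentagonal (int n) \<Longrightarrow> 2 dvd fps_nth eta_odd (8 * n)"
proof -
  have 8: "8 dvd fps_nth eta_odd i - fps_nth (dilate 2 (euler ^ 4)) i" for i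
    using fps_nth_dvd[OF eta_odd_cong, of i] by simp
  have "4 dvd eta_odd - dilate 2 (euler ^ 4)"
    by (rule dvd_trans[OF four_dvd_eight eta_odd_cong])
  moreover have "4 dvd dilate 2 (euler ^ 4) - dilate 2 (dilate 2 euler ^ 2)"
    by (rule dilate_dvd[OF euler_4_cong]) simp
  ultimately have "4 dvd eta_odd - dilate 2 (dilate 2 euler ^ 2)"
    by (rule dvd_diff_trans)
  then have "4 dvd eta_odd - dilate 4 (euler ^ 2)"
    by (simp add: dilate_power dilate_dilate)
  then have 4: "4 dvd fps_nth eta_odd i - fps_nth (dilate 4 (euler ^ 2)) i" for i
    using fps_nth_dvd[of _ _ i] by fastforce
  have "2 dvd eta_odd - dilate 2 (euler ^ 4)"
    by (rule dvd_trans[OF two_dvd_eight eta_odd_cong])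
  moreover have "2 dvd dilate 2 (euler ^ 4) - dilate 2 (dilate 4 euler)"
    by (rule dilate_dvd[OF euler_4_cong_2]) simp
  ultimately have "2 dvd eta_odd - dilate 2 (dilate 4 euler)"
    by (rule dvd_diff_trans)
  then have "2 dvd eta_odd - dilate 8 euler"
    by (simp add: dilate_dilate)
  then have 2: "2 dvd fps_nth eta_odd i - fps_nth (dilate 8 euler) i" for i
    using fps_nth_dvd[of _ _ i] by fastforce
  show "8 dvd fps_nth eta_odd (2 * n + 1)"
    using 8[of "2 * n + 1"] by (simp add: fps_nth_dilate)
  have "\<not> 4 dvd 4 * n + 2" by presburger
  then show "4 dvd fps_nth eta_odd (4 * n + 2)"
    using 4[of "4 * n + 2"] by (simp add: fps_nth_dilate)
  have "\<not> 8 dvd 8 * n + 4" by presburger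
  then show "2 dvd fps_nth eta_odd (8 * n + 4)"
    using 2[of "8 * n + 4"] by (simp add: fps_nth_dilate)
  show "2 dvd fps_nth eta_odd (8 * n)" if "\<not> generalised_pentagonal (int n)"
    using 2[of "8 * n"] fps_nth_euler_not_pentagonal[OF that] by (simp add: fps_nth_dilate)
  \<comment> \<open>An odd index, where the series in \<open>q^2\<close> has coefficient 0.\<close>
  have "8 dvd fps_nth (odd_part (euler ^ 4)) (2 * n + 1)"
    using fps_nth_dvd[OF odd_part_euler_4_cong, of "2 * n + 1"]
    by (simp add: fps_nth_dilate numeral_fps_const)
  moreover have "fps_nth (odd_part (euler ^ 4)) (2 * n + 1) = fps_nth (euler ^ 4) (4 * n + 3)"
    unfolding fps_nth_odd_part by (rule arg_cong[where f = "fps_nth _"]) simp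
  ultimately have "8 dvd fps_nth (euler ^ 4) (4 * n + 3)" by simp
  then show "8 dvd fps_nth eta_odd (8 * n + 6)"
    using 8[of "8 * n + 6"] by (simp add: fps_nth_dilate) presburger
qed

text \<open>Modulo 128 the odd part is \<open>32 f2^10\<close>, which has no odd powers of
  \<open>q\<close>. Modulo 2, \<open>f2^10\<close> is \<open>f4^5\<close>, so at index
  \<open>4 n + 2\<close> of the odd part one more factor 2 appears.\<close>

lemma fps_nth_eta_even:
  shows fps_nth_eta_even_1: "32 dvd fps_nth eta_even (2 * n + 1)"
    and fps_nth_eta_even_3: "128 dvd fps_nth eta_even (4 * n + 3)"
    and fps_nth_eta_even_5: "64 dvd fps_nth eta_even (8 * n + 5)"
proof -
  have 128: "128 dvd fps_nth eta_even (2 * i + 1) - 32 * fps_nth (dilate 2 (euler ^ 10)) i" for i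
    using fps_nth_dvd[OF odd_part_eta_even_cong, of i] by (simp add: numeral_fps_const)
  have 2: "2 dvd fps_nth (dilate 2 (euler ^ 10)) i - fps_nth (dilate 4 (euler ^ 5)) i" for i
    using fps_nth_dvd[OF euler_10_cong, of i] by simp
  show "32 dvd fps_nth eta_even (2 * n + 1)"
    using 128[of n] by presburger
  have "fps_nth (dilate 2 (euler ^ 10)) (2 * n + 1) = 0"
    by (simp add: fps_nth_dilate)
  moreover have "2 * (2 * n + 1) + 1 = 4 * n + 3" by simp
  ultimately show "128 dvd fps_nth eta_even (4 * n + 3)"
    using 128[of "2 * n + 1"] by (simp only: mult_zero_right diff_zero)
  have "\<not> 4 dvd 4 * n + 2" by presburger
  then have "fps_nth (dilate 4 (euler ^ 5)) (4 * n + 2) = 0"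
    by (simp add: fps_nth_dilate)
  moreover have "8 * n + 5 = 2 * (4 * n + 2) + 1" by simp
  ultimately show "64 dvd fps_nth eta_even (8 * n + 5)"
    using 128[of "4 * n + 2"] 2[of "4 * n + 2"] by presburger
qed

lemma p8_slice_dvd:
  assumes "d dvd fps_nth eta_odd i" "d dvd 128"
  shows "8 ^ (\<beta> + 1) * d dvd fps_nth (p8_slice \<beta>) i"
proof -
  obtain c R where "p8_slice \<beta> = 8 ^ (\<beta> + 1) * (fps_const c * eta_odd + 128 * R)"
    by (rule p8_slice_cong)
  then have "fps_nth (p8_slice \<beta>) i = 8 ^ (\<beta> + 1) * (c * fps_nth eta_odd i + 128 * fps_nth R i)"
    by (simp only: eight_power_fps) (simp add: numeral_fps_const)
  moreover have "d dvd c * fps_nth eta_odd i + 128 * fps_nth R i"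
    using assms by simp
  ultimately show ?thesis
    by (simp only: mult_dvd_mono[OF dvd_refl])
qed

lemma p8_slice_odd_dvd:
  assumes "d dvd fps_nth eta_even i" "d dvd 128"
  shows "8 ^ (\<beta> + 2) * d dvd fps_nth (p8_slice \<beta>) (2 * i + 1)"
proof -
  obtain c R where "odd_part (p8_slice \<beta>) = 8 ^ (\<beta> + 2) * (fps_const c * eta_even + 128 * R)"
    by (rule odd_part_p8_slice_cong)
  then have "fps_nth (odd_part (p8_slice \<beta>)) i = 8 ^ (\<beta> + 2) * (c * fps_nth eta_even i + 128 * fps_nth R i)"
    by (simp only: eight_power_fps) (simp add: numeral_fps_const)
  moreover have "d dvd c * fps_nth eta_even i + 128 * fps_nth R i"
    using assms by simp
  ultimately show ?thesis
    unfolding fps_nth_odd_part by (simp only: mult_dvd_mono[OF dvd_refl])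
qed

theorem theorem1p1:
  fixes n \<alpha> :: nat
  assumes "\<alpha> \<ge> 1"
  shows "[p8 (2 * n + 1) = 0] (mod 2 ^ 3) \<and>
         [p8 (2 ^ (2 * \<alpha>) * n + (2 ^ (2 * \<alpha> + 1) + 1) div 3) = 0] (mod 2 ^ (3 * \<alpha> + 3)) \<and>
         [p8 (2 ^ (2 * \<alpha> + 1) * n + (7 * 2 ^ (2 * \<alpha> - 1) + 1) div 3) = 0] (mod 2 ^ (3 * \<alpha> + 2)) \<and>
         [p8 (2 ^ (2 * \<alpha> + 1) * n + (5 * 2 ^ (2 * \<alpha>) + 1) div 3) = 0] (mod 2 ^ (3 * \<alpha> + 8)) \<and>
         [p8 (2 ^ (2 * \<alpha> + 2) * n + (13 * 2 ^ (2 * \<alpha> - 1) + 1) div 3) = 0] (mod 2 ^ (3 * \<alpha> + 1)) \<and>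
         [p8 (2 ^ (2 * \<alpha> + 2) * n + (19 * 2 ^ (2 * \<alpha> - 1) + 1) div 3) = 0] (mod 2 ^ (3 * \<alpha> + 3)) \<and>
         [p8 (2 ^ (2 * \<alpha> + 2) * n + (11 * 2 ^ (2 * \<alpha>) + 1) div 3) = 0] (mod 2 ^ (3 * \<alpha> + 10)) \<and>
         [p8 (2 ^ (2 * \<alpha> + 3) * n + (17 * 2 ^ (2 * \<alpha>) + 1) div 3) = 0] (mod 2 ^ (3 * \<alpha> + 9)) \<and>
         (\<not> generalised_pentagonal (int n) \<longrightarrow>
           [p8 (2 ^ (2 * \<alpha> + 2) * n + (2 ^ (2 * \<alpha> - 1) + 1) div 3) = 0] (mod 2 ^ (3 * \<alpha> + 1)))"
proof -
  obtain \<beta> where \<alpha>: "\<alpha> = Suc \<beta>"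
    using assms by (cases \<alpha>) auto
  obtain w where w: "2 ^ (2 * \<beta> + 1) = 3 * w + (2::nat)"
    using two_power_odd_mod_3 by blast
  \<comment> \<open>\<open>A\<close> is \<open>2 ^ (2 * \<alpha> - 1)\<close>, and a residue
    \<open>(c A + 1) / 3\<close> is position \<open>(c - 1) / 3\<close> of the slice:
    \<open>c\<close> = 1, 4, 7, 13, 19 give 0, 1, 2, 4, 6, handled through \<open>eta_odd\<close>;
    \<open>c\<close> = 10, 22, 34 give the odd positions 3, 7, 11, handled through
    \<open>eta_even\<close>.\<close>
  define A where "A = 3 * w + 2"
  have slice: "fps_nth (p8_slice \<beta>) i = int (p8 (A * i + (w + 1)))" for i
    unfolding p8_slice_def fps_nth_Abs_fps w A_def by simp
  have pow: "(2::nat) ^ (2 * \<alpha> - 1) = A" "(2::nat) ^ (2 * \<alpha>) = 2 * A"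
    "(2::nat) ^ (2 * \<alpha> + 1) = 4 * A" "(2::nat) ^ (2 * \<alpha> + 2) = 8 * A" "(2::nat) ^ (2 * \<alpha> + 3) = 16 * A"
    using w by (simp_all add: \<alpha> A_def power_add)
  have cong: "[p8 N = 0] (mod 2 ^ (3 * \<alpha> + r))"
    if "8 ^ (\<beta> + 1) * 2 ^ r dvd fps_nth (p8_slice \<beta>) i" "N = A * i + (w + 1)" for N i r
  proof -
    have "(8::int) ^ (\<beta> + 1) * 2 ^ r = (2 ^ 3) ^ \<alpha> * 2 ^ r"
      by (simp add: \<alpha>)
    also have "\<dots> = 2 ^ (3 * \<alpha> + r)"
      by (simp only: power_mult power_add)
    also have "\<dots> = int (2 ^ (3 * \<alpha> + r))"
      by simp
    finally have "int (2 ^ (3 * \<alpha> + r)) dvd int (p8 N)"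
      using that by (simp only: slice)
    then show ?thesis
      by (simp only: int_dvd_int_iff cong_0_iff)
  qed
  \<comment> \<open>The 3 in \<open>r + 3\<close> is the extra factor 8 of the half round.\<close>
  have odd: "8 ^ (\<beta> + 1) * 2 ^ (r + 3) dvd fps_nth (p8_slice \<beta>) (2 * i + 1)"
    if "2 ^ r dvd fps_nth eta_even i" "(2::int) ^ r dvd 128" for i r
    using p8_slice_odd_dvd[OF that, of \<beta>] by (simp add: power_add mult_ac)
  have "int (p8 (2 * n + 1)) = 8 * fps_nth eta_odd n"
    using arg_cong[OF p8_slice_0, of "\<lambda>F. fps_nth F n"] by (simp add: p8_slice_def numeral_fps_const)
  then have "int 8 dvd int (p8 (2 * n + 1))" by simp
  then have 1: "[p8 (2 * n + 1) = 0] (mod 2 ^ 3)"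
    by (simp only: int_dvd_int_iff cong_0_iff) simp
  have 2: "[p8 (2 * A * n + (4 * A + 1) div 3) = 0] (mod 2 ^ (3 * \<alpha> + 3))"
    by (rule cong[OF p8_slice_dvd[of "2 ^ 3" "2 * n + 1"]])
      (use fps_nth_eta_odd_1 in \<open>simp_all add: A_def algebra_simps\<close>)
  have 3: "[p8 (4 * A * n + (7 * A + 1) div 3) = 0] (mod 2 ^ (3 * \<alpha> + 2))"
    by (rule cong[OF p8_slice_dvd[of "2 ^ 2" "4 * n + 2"]])
      (use fps_nth_eta_odd_2 in \<open>simp_all add: A_def algebra_simps\<close>)
  have 4: "[p8 (4 * A * n + (5 * (2 * A) + 1) div 3) = 0] (mod 2 ^ (3 * \<alpha> + (5 + 3)))"
    by (rule cong[OF odd[of 5 "2 * n + 1"]])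
      (use fps_nth_eta_even_1 in \<open>simp_all add: A_def algebra_simps\<close>)
  have 5: "[p8 (8 * A * n + (13 * A + 1) div 3) = 0] (mod 2 ^ (3 * \<alpha> + 1))"
    by (rule cong[OF p8_slice_dvd[of "2 ^ 1" "8 * n + 4"]])
      (use fps_nth_eta_odd_4 in \<open>simp_all add: A_def algebra_simps\<close>)
  have 6: "[p8 (8 * A * n + (19 * A + 1) div 3) = 0] (mod 2 ^ (3 * \<alpha> + 3))"
    by (rule cong[OF p8_slice_dvd[of "2 ^ 3" "8 * n + 6"]])
      (use fps_nth_eta_odd_6 in \<open>simp_all add: A_def algebra_simps\<close>)
  have 7: "[p8 (8 * A * n + (11 * (2 * A) + 1) div 3) = 0] (mod 2 ^ (3 * \<alpha> + (7 + 3)))"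
    by (rule cong[OF odd[of 7 "4 * n + 3"]])
      (use fps_nth_eta_even_3 in \<open>simp_all add: A_def algebra_simps\<close>)
  have 8: "[p8 (16 * A * n + (17 * (2 * A) + 1) div 3) = 0] (mod 2 ^ (3 * \<alpha> + (6 + 3)))"
    by (rule cong[OF odd[of 6 "8 * n + 5"]])
      (use fps_nth_eta_even_5 in \<open>simp_all add: A_def algebra_simps\<close>)
  have 9: "[p8 (8 * A * n + (A + 1) div 3) = 0] (mod 2 ^ (3 * \<alpha> + 1))"
    if "\<not> generalised_pentagonal (int n)"
    by (rule cong[OF p8_slice_dvd[of "2 ^ 1" "8 * n"]])
      (use fps_nth_eta_odd_0[OF that] in \<open>simp_all add: A_def algebra_simps\<close>)
  have "5 + 3 = (8::nat)" "7 + 3 = (10::nat)" "6 + 3 = (9::nat)" by simp_all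
  then show ?thesis
    unfolding pow using 1 2 3 4 5 6 7 8 9 by (simp only:) blast
qed

end
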